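(* Let $\mu=(\mu_1\ge\cdots\ge\mu_n\ge 0)$ be a partition with $n\ge 1$ (possibly zero) parts. Then there exist bijections between the following four finite sets: 1. the set of Case 2 sequences of partitions with final partition $\mu$ and $\ell=2n+1$; 2. the set of super symplectic semistandard tableaux of shape $\mu$ with all entries less than $n+1$ (i.e. with entries in $1<\overline{1}<2<\overline{2}<\cdots<n<\overline{n}$); 3. the set of $n$-tuples $(p_1,\ldots,p_n)$ of pairwise non-intersecting H-Delannoy paths, where $p_i$ starts at $(-i,i)$ and ends at $(\mu_i-i,n+1)$ for $1\le i\le n$; 4. the set of domino tilings of the generalized Aztec triangle of type 2 corresponding to $\mu$.
   Context: For partitions $\lambda\supseteq\nu$, the skew diagram $\lambda/\nu$ is the set of boxes of the Young diagram of $\lambda$ not in that of $\nu$; it is a horizontal strip if it has at most one box in each column, a vertical strip if it has at most one box in each row. Case 2 sequences ($\ell=2n+1$): sequences of partitions $\lambda^{(0)},\ldots,\lambda^{(\ell-1)}$ such that (1) $\lambda^{(0)}$ is empty; (2) $\lambda^{(\ell-1)}=\mu$; (3) $\lambda^{(2i+1)}/\lambda^{(2i)}$ is a horizontal strip (in particular $\lambda^{(2i)}\subseteq\lambda^{(2i+1)}$); (4) $\lambda^{(2i)}/\lambda^{(2i-1)}$ is a vertical strip (in particular $\lambda^{(2i-1)}\subseteq\lambda^{(2i)}$); (5) $\lambda^{(i)}$ has at most $\lceil i/2\rceil$ nonzero parts; conditions (3)–(5) are required for all indices in range. A super symplectic semistandard tableau of shape $\mu$ is a filling of the boxes of the Young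 diagram of $\mu$ (rows left-justified, row 1 on top with $\mu_1$ boxes) with entries from $1<\overline{1}<2<\overline{2}<\cdots$ such that: (1) rows and columns are weakly increasing; (2) for all $i$, the entries $i$ form a horizontal strip (at most one $i$ in each column); (3) for all $i$, the entries $\overline{i}$ form a vertical strip (at most one $\overline{i}$ in each row); (4) $i$ and $\overline{i}$ do not appear below the $i$th row. An H-Delannoy path is a lattice path in $\mathbb{Z}^2$ with steps $(1,0)$ (east), $(0,1)$ (north), $(1,1)$ (northeast) which, if its endpoint is $(a,b)$, does not pass through $(a-1,b)$ (i.e. its last step is not an east step). Paths are non-intersecting if no two of them share a lattice point. A domino is the union of two unit squares (with vertices in $\mathbb{Z}^2$) sharing an edge; a domino tiling of a finite union $D$ of unit squares is a set of dominoes with pairwise disjoint interiors whose union is $D$. For integers $c,d\ge0$ let $Q(c,d)=[c,c+1]\times[c-d,c-d+1]$ (a square of diagonal $d$). Put $P=\{\mu_j+n-j:1\le j\le n\}\subseteq\{0,\ldots,\mu_1+n-1\}$. The generalized Aztec triangle of type 2 corresponding to $\mu$ is the union of all squares $Q(c,d)$ with $0\le d\le 2n-1$ and $0\le c<\mu_1+\lceil d/2\rceil$, together with the squares $Q(c,2n)$ for $c\in P$. *)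

theory Defs
  imports "HOL-Analysis.Analysis"
begin

text \<open>
  A partition is the sequence of its parts \<open>\<lambda> 1 \<ge> \<lambda> 2 \<ge> \<dots>\<close>, padded with zeros; the
  index 0 is not used, and fixing \<open>\<lambda> 0 = 0\<close> makes the representation unique.
\<close>

definition is_partition :: "(nat \<Rightarrow> nat) \<Rightarrow> bool" where
  "is_partition lam \<longleftrightarrow>
     lam 0 = 0 \<and> (\<forall>i\<ge>1. lam (Suc i) \<le> lam i) \<and> finite {i. lam i \<noteq> 0}"

definition num_parts :: "(nat \<Rightarrow> nat) \<Rightarrow> nat" where
  "num_parts lam = card {i. lam i \<noteq> 0}"

text \<open>Boxes are pairs (row, column), both counted from 1.\<close>

definition young_diagram :: "(nat \<Rightarrow> nat) \<Rightarrow> (nat \<times> nat) set" where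
  "young_diagram lam = {(i, j). 1 \<le> i \<and> 1 \<le> j \<and> j \<le> lam i}"

definition horizontal_strip :: "(nat \<times> nat) set \<Rightarrow> bool" where
  "horizontal_strip S \<longleftrightarrow> (\<forall>b\<in>S. \<forall>b'\<in>S. snd b = snd b' \<longrightarrow> b = b')"

definition vertical_strip :: "(nat \<times> nat) set \<Rightarrow> bool" where
  "vertical_strip S \<longleftrightarrow> (\<forall>b\<in>S. \<forall>b'\<in>S. fst b = fst b' \<longrightarrow> b = b')"

definition horizontal_skew :: "(nat \<Rightarrow> nat) \<Rightarrow> (nat \<Rightarrow> nat) \<Rightarrow> bool" where
  "horizontal_skew lam nu \<longleftrightarrow>
     young_diagram nu \<subseteq> young_diagram lam \<and>
     horizontal_strip (young_diagram lam - young_diagram nu)"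

definition vertical_skew :: "(nat \<Rightarrow> nat) \<Rightarrow> (nat \<Rightarrow> nat) \<Rightarrow> bool" where
  "vertical_skew lam nu \<longleftrightarrow>
     young_diagram nu \<subseteq> young_diagram lam \<and>
     vertical_strip (young_diagram lam - young_diagram nu)"

text \<open>\<open>(i + 1) div 2\<close> is the ceiling of \<open>i / 2\<close>.\<close>

definition case2_sequences :: "nat \<Rightarrow> (nat \<Rightarrow> nat) \<Rightarrow> (nat \<Rightarrow> nat) list set" where
  "case2_sequences l mu =
     {L. length L = l \<and> (\<forall>i<l. is_partition (L ! i)) \<and>
         L ! 0 = (\<lambda>_. 0) \<and>
         L ! (l - 1) = mu \<and>
         (\<forall>i. 2 * i + 1 < l \<longrightarrow> horizontal_skew (L ! (2 * i + 1)) (L ! (2 * i))) \<and>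
         (\<forall>i\<ge>1. 2 * i < l \<longrightarrow> vertical_skew (L ! (2 * i)) (L ! (2 * i - 1))) \<and>
         (\<forall>i<l. num_parts (L ! i) \<le> (i + 1) div 2)}"

text \<open>
  The alphabet \<open>1 < 1' < 2 < 2' < \<dots>\<close>, with \<open>Barred i\<close> for the barred letter. The letters
  of index 0 are excluded in the definition of tableaux.
\<close>

datatype letter = is_Unbarred: Unbarred (idx: nat) | is_Barred: Barred (idx: nat)

instantiation letter :: linorder
begin

definition less_eq_letter :: "letter \<Rightarrow> letter \<Rightarrow> bool" where
  "x \<le> y \<longleftrightarrow> idx x < idx y \<or> (idx x = idx y \<and> (is_Barred x \<longrightarrow> is_Barred y))"

definition less_letter :: "letter \<Rightarrow> letter \<Rightarrow> bool" where
  "x < y \<longleftrightarrow> idx x < idx y \<or> (idx x = idx y \<and> is_Unbarred x \<and> is_Barred y)"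

instance
proof
  fix x y z :: letter
  show "x < y \<longleftrightarrow> x \<le> y \<and> \<not> y \<le> x"
    by (cases x; cases y) (auto simp: less_eq_letter_def less_letter_def)
  show "x \<le> x"
    by (simp add: less_eq_letter_def)
  show "x \<le> y \<Longrightarrow> y \<le> z \<Longrightarrow> x \<le> z"
    by (auto simp: less_eq_letter_def)
  show "x \<le> y \<Longrightarrow> y \<le> x \<Longrightarrow> x = y"
    by (cases x; cases y) (auto simp: less_eq_letter_def)
  show "x \<le> y \<or> y \<le> x"
    by (auto simp: less_eq_letter_def)
qed

end

text \<open>Fillings are undefined outside the diagram, so that distinct functions are distinct fillings.\<close>

definition super_symplectic_tableaux :: "(nat \<Rightarrow> nat) \<Rightarrow> (nat \<times> nat \<Rightarrow> letter) set" where
  "super_symplectic_tableaux mu =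
     {T \<in> young_diagram mu \<rightarrow>\<^sub>E {x. 1 \<le> idx x}.
         (\<forall>i j j'. (i, j) \<in> young_diagram mu \<and> (i, j') \<in> young_diagram mu \<and> j \<le> j'
                     \<longrightarrow> T (i, j) \<le> T (i, j')) \<and>
         (\<forall>i i' j. (i, j) \<in> young_diagram mu \<and> (i', j) \<in> young_diagram mu \<and> i \<le> i'
                     \<longrightarrow> T (i, j) \<le> T (i', j)) \<and>
         (\<forall>k\<ge>1. horizontal_strip {b \<in> young_diagram mu. T b = Unbarred k}) \<and>
         (\<forall>k\<ge>1. vertical_strip {b \<in> young_diagram mu. T b = Barred k}) \<and>
         (\<forall>k\<ge>1. \<forall>(i, j)\<in>young_diagram mu. T (i, j) \<in> {Unbarred k, Barred k} \<longrightarrow> i \<le> k)}"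

definition tableaux_below :: "letter \<Rightarrow> (nat \<Rightarrow> nat) \<Rightarrow> (nat \<times> nat \<Rightarrow> letter) set" where
  "tableaux_below x mu =
     {T \<in> super_symplectic_tableaux mu. \<forall>b\<in>young_diagram mu. T b < x}"

definition delannoy_step :: "int \<times> int \<Rightarrow> int \<times> int \<Rightarrow> bool" where
  "delannoy_step u v \<longleftrightarrow>
     v \<in> {(fst u + 1, snd u), (fst u, snd u + 1), (fst u + 1, snd u + 1)}"

text \<open>A path is the list of the lattice points it visits.\<close>

definition h_delannoy_paths :: "int \<times> int \<Rightarrow> int \<times> int \<Rightarrow> (int \<times> int) list set" where
  "h_delannoy_paths u v =
     {p. p \<noteq> [] \<and> hd p = u \<and> last p = v \<and> successively delannoy_step p \<and>
         (fst v - 1, snd v) \<notin> set p}"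

definition nonintersecting_h_delannoy ::
    "nat \<Rightarrow> (nat \<Rightarrow> nat) \<Rightarrow> (nat \<Rightarrow> (int \<times> int) list) set" where
  "nonintersecting_h_delannoy n mu =
     {p \<in> (\<Pi>\<^sub>E i\<in>{1..n}. h_delannoy_paths (- int i, int i) (int (mu i) - int i, int n + 1)).
         \<forall>i\<in>{1..n}. \<forall>j\<in>{1..n}. i \<noteq> j \<longrightarrow> set (p i) \<inter> set (p j) = {}}"

definition unit_square :: "int \<Rightarrow> int \<Rightarrow> (real \<times> real) set" where
  "unit_square a b = {of_int a .. of_int a + 1} \<times> {of_int b .. of_int b + 1}"

definition is_domino :: "(real \<times> real) set \<Rightarrow> bool" where
  "is_domino X \<longleftrightarrow>
     (\<exists>a b. X = unit_square a b \<union> unit_square (a + 1) b \<or>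
            X = unit_square a b \<union> unit_square a (b + 1))"

definition domino_tilings :: "(real \<times> real) set \<Rightarrow> (real \<times> real) set set set" where
  "domino_tilings D =
     {T. (\<forall>X\<in>T. is_domino X) \<and>
         (\<forall>X\<in>T. \<forall>Y\<in>T. X \<noteq> Y \<longrightarrow> interior X \<inter> interior Y = {}) \<and>
         \<Union>T = D}"

definition diag_square :: "nat \<Rightarrow> nat \<Rightarrow> (real \<times> real) set" where
  "diag_square c d = unit_square (int c) (int c - int d)"

text \<open>\<open>(d + 1) div 2\<close> is the ceiling of \<open>d / 2\<close>; the subtraction is exact since \<open>j \<le> n\<close>.\<close>

definition aztec_triangle2 :: "nat \<Rightarrow> (nat \<Rightarrow> nat) \<Rightarrow> (real \<times> real) set" where
  "aztec_triangle2 n mu =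
     \<Union>{diag_square c d | c d. d \<le> 2 * n - 1 \<and> c < mu 1 + (d + 1) div 2} \<union>
     \<Union>{diag_square c (2 * n) | c. c \<in> {mu j + n - j | j. 1 \<le> j \<and> j \<le> n}}"

end

theory Submission
  imports Defs
begin

text \<open>
  All four sets are put in bijection with the sequences of partitions; finiteness only has to
  be checked for tableaux, where it is clear.

  A tableau is a sequence of partitions read off by its entries: the boxes that carry one of
  the first \<open>d\<close> letters form the partition numbered \<open>d\<close>. The bound on the rows of \<open>i\<close> and its
  barred copy is the bound on the number of parts (\<open>bij_betw_chains_tableaux\<close>).

  The path with index \<open>i\<close> is the history of the \<open>i\<close>-th part, shifted to the left by \<open>i\<close>. The
  horizontal strips give its east steps, of which there may be several at each height; the
  vertical strips tell whether it goes up by a north or a northeast step. Two consecutive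
  paths avoid each other at a given height exactly when the two partitions around the
  horizontal strip interlace, and the points where they enter the next height differ exactly
  when the vertical strip leads to a partition again (\<open>bij_betw_chains_paths\<close>).

  In a tiling each domino joins a cell of a diagonal \<open>d\<close> to a cell of the next diagonal, in
  the same column or one column further. So a tiling is a sequence of perfect matchings: the
  cells of diagonal \<open>d\<close> split into those matched downwards and those matched upwards, and the
  latter are matched with the downward cells of diagonal \<open>d + 1\<close>. Such a matching is
  determined by the two matched sets (\<open>shift_matching_unique\<close>), so only these sets matter.
  Take as particles the downward cells on even diagonals and the upward cells on odd ones.
  Comparing sizes along the diagonals shows that there are \<open>\<lceil>d / 2\<rceil>\<close> particles on diagonal \<open>d\<close>,
  and these encode a partition with at most that many parts, the one with parts
  \<open>x\<^sub>j - (m - j)\<close> if \<open>x\<^sub>1 > \<dots> > x\<^sub>m\<close> are the particles. From an odd diagonal to the next the dominoes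
  move each particle by 0 or 1, which is a vertical strip (\<open>vertical_iff_matching\<close>); from an even
  diagonal they move each hole by 0 or 1, which makes the particles interlace and so is a
  horizontal strip (\<open>interlacing_iff_matching\<close>). The cells that are present on the last
  diagonal encode the final partition (\<open>bij_betw_chains_tilings\<close>).
\<close>

section \<open>Partitions and strips\<close>

lemma partition_antimono:
  assumes "is_partition lam" "1 \<le> i" "i \<le> j"
  shows "lam j \<le> lam i"
  using assms(3)
proof (induction j rule: dec_induct)
  case (step k)
  then have "lam (Suc k) \<le> lam k"
    using assms by (simp add: is_partition_def)
  with step show ?case by simp
qed simp

lemma num_parts_le_iff:
  assumes lam: "is_partition lam"
  shows "num_parts lam \<le> m \<longleftrightarrow> (\<forall>i>m. lam i = 0)"
proof
  assume le: "num_parts lam \<le> m"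
  show "\<forall>i>m. lam i = 0"
  proof (intro allI impI, rule ccontr)
    fix i assume i: "m < i" and nz: "lam i \<noteq> 0"
    have "{1..i} \<subseteq> {k. lam k \<noteq> 0}"
    proof
      fix k assume "k \<in> {1..i}"
      then have "lam i \<le> lam k"
        using partition_antimono[OF lam, of k i] by simp
      with nz show "k \<in> {k. lam k \<noteq> 0}" by simp
    qed
    moreover have "finite {k. lam k \<noteq> 0}"
      using lam by (simp add: is_partition_def)
    ultimately have "card {1..i} \<le> num_parts lam"
      unfolding num_parts_def by (rule card_mono[rotated])
    with le i show False by simp
  qed
next
  assume zero: "\<forall>i>m. lam i = 0"
  have "{k. lam k \<noteq> 0} \<subseteq> {1..m}"
  proof
    fix k assume k: "k \<in> {k. lam k \<noteq> 0}"
    then have "k \<noteq> 0"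
      using lam by (auto simp: is_partition_def intro!: gr0I)
    moreover have "k \<le> m"
      using k zero by (meson mem_Collect_eq not_le)
    ultimately show "k \<in> {1..m}" by simp
  qed
  then have "card {k. lam k \<noteq> 0} \<le> card {1..m}"
    by (intro card_mono) auto
  then show "num_parts lam \<le> m"
    by (simp add: num_parts_def)
qed

lemma is_partitionI:
  assumes "lam 0 = 0" "\<And>i. 1 \<le> i \<Longrightarrow> lam (Suc i) \<le> lam i" "\<And>i. m < i \<Longrightarrow> lam i = 0"
  shows "is_partition lam"
proof -
  have "{i. lam i \<noteq> 0} \<subseteq> {..m}"
    using assms(3) by (auto simp: not_less[symmetric])
  then have "finite {i. lam i \<noteq> 0}"
    by (rule finite_subset) simp
  with assms(1,2) show ?thesis
    by (simp add: is_partition_def)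
qed

lemma in_young_diagram [simp]:
  "(i, j) \<in> young_diagram lam \<longleftrightarrow> 1 \<le> i \<and> 1 \<le> j \<and> j \<le> lam i"
  by (simp add: young_diagram_def)

lemma young_diagram_subset_iff:
  "young_diagram nu \<subseteq> young_diagram lam \<longleftrightarrow> (\<forall>i\<ge>1. nu i \<le> lam i)"
proof
  assume sub: "young_diagram nu \<subseteq> young_diagram lam"
  show "\<forall>i\<ge>1. nu i \<le> lam i"
  proof (intro allI impI)
    fix i :: nat assume i: "1 \<le> i"
    show "nu i \<le> lam i"
    proof (cases "nu i = 0")
      case False
      with i have "(i, nu i) \<in> young_diagram nu" by simp
      with sub have "(i, nu i) \<in> young_diagram lam" by blast
      then show ?thesis by simp
    qed simp
  qed
next
  assume le: "\<forall>i\<ge>1. nu i \<le> lam i"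
  show "young_diagram nu \<subseteq> young_diagram lam"
  proof
    fix b assume "b \<in> young_diagram nu"
    with le show "b \<in> young_diagram lam"
      by (cases b) (auto intro: order_trans)
  qed
qed

lemma finite_young_diagram:
  assumes lam: "is_partition lam"
  shows "finite (young_diagram lam)"
proof (rule finite_subset)
  show "young_diagram lam \<subseteq> (SIGMA i:{i. lam i \<noteq> 0}. {1..lam i})"
    by auto
  show "finite (SIGMA i:{i. lam i \<noteq> 0}. {1..lam i})"
    using lam by (simp add: is_partition_def)
qed

text \<open>
  A column with two boxes of a skew diagram contains two vertically adjacent ones, so the
  horizontal strip condition only has to be tested on consecutive rows. It then says that
  the two partitions interlace.
\<close>

lemma horizontal_skew_iff_interlacing:
  assumes lam: "is_partition lam" and nu: "is_partition nu"
  shows "horizontal_skew lam nu \<longleftrightarrow> (\<forall>i\<ge>1. nu i \<le> lam i \<and> lam (Suc i) \<le> nu i)"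
proof
  assume h: "horizontal_skew lam nu"
  then have le: "\<And>i. i \<ge> 1 \<Longrightarrow> nu i \<le> lam i"
    by (simp add: horizontal_skew_def young_diagram_subset_iff)
  have "lam (Suc i) \<le> nu i" if i: "1 \<le> i" for i
  proof (rule ccontr)
    assume less: "\<not> lam (Suc i) \<le> nu i"
    have "lam (Suc i) \<le> lam i" "nu (Suc i) \<le> nu i"
      using i partition_antimono[OF lam, of i "Suc i"] partition_antimono[OF nu, of i "Suc i"]
      by simp_all
    with less i have "(i, lam (Suc i)) \<in> young_diagram lam - young_diagram nu"
      "(Suc i, lam (Suc i)) \<in> young_diagram lam - young_diagram nu"
      by auto
    with h show False
      unfolding horizontal_skew_def horizontal_strip_def by (metis n_not_Suc_n fst_conv snd_conv)
  qed
  with le show "\<forall>i\<ge>1. nu i \<le> lam i \<and> lam (Suc i) \<le> nu i" by blast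
next
  assume r: "\<forall>i\<ge>1. nu i \<le> lam i \<and> lam (Suc i) \<le> nu i"
  have no: False
    if "1 \<le> i" "i < i'" "j \<le> lam i'" "nu i < j" for i i' j
  proof -
    have "lam i' \<le> lam (Suc i)"
      using that partition_antimono[OF lam, of "Suc i" i'] by simp
    also have "\<dots> \<le> nu i" using r that by simp
    finally show False using that by simp
  qed
  have "horizontal_strip (young_diagram lam - young_diagram nu)"
    unfolding horizontal_strip_def
  proof (intro ballI impI)
    fix b b' assume b: "b \<in> young_diagram lam - young_diagram nu"
      and b': "b' \<in> young_diagram lam - young_diagram nu" and eq: "snd b = snd b'"
    obtain i j i' where [simp]: "b = (i, j)" "b' = (i', j)"
      using eq by (metis prod.collapse)
    show "b = b'"
      using b b' no[of i i' j] no[of i' i j] by (cases i i' rule: linorder_cases) auto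
  qed
  with r show "horizontal_skew lam nu"
    by (simp add: horizontal_skew_def young_diagram_subset_iff)
qed

lemma vertical_skew_iff:
  "vertical_skew lam nu \<longleftrightarrow> (\<forall>i\<ge>1. nu i \<le> lam i \<and> lam i \<le> Suc (nu i))"
proof
  assume v: "vertical_skew lam nu"
  then have le: "\<And>i. i \<ge> 1 \<Longrightarrow> nu i \<le> lam i"
    by (simp add: vertical_skew_def young_diagram_subset_iff)
  have "lam i \<le> Suc (nu i)" if i: "1 \<le> i" for i
  proof (rule ccontr)
    assume "\<not> lam i \<le> Suc (nu i)"
    with i have "(i, lam i) \<in> young_diagram lam - young_diagram nu"
      "(i, Suc (nu i)) \<in> young_diagram lam - young_diagram nu" "Suc (nu i) \<noteq> lam i"
      by auto
    with v show False
      unfolding vertical_skew_def vertical_strip_def by (metis fst_conv snd_conv)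
  qed
  with le show "\<forall>i\<ge>1. nu i \<le> lam i \<and> lam i \<le> Suc (nu i)" by blast
next
  assume r: "\<forall>i\<ge>1. nu i \<le> lam i \<and> lam i \<le> Suc (nu i)"
  have "vertical_strip (young_diagram lam - young_diagram nu)"
    unfolding vertical_strip_def
  proof (intro ballI impI)
    fix b b' assume b: "b \<in> young_diagram lam - young_diagram nu"
      and b': "b' \<in> young_diagram lam - young_diagram nu" and eq: "fst b = fst b'"
    obtain i j j' where [simp]: "b = (i, j)" "b' = (i, j')"
      using eq by (metis prod.collapse)
    have "lam i \<le> Suc (nu i)" using r b by simp
    with b b' show "b = b'" by auto
  qed
  with r show "vertical_skew lam nu"
    by (simp add: vertical_skew_def young_diagram_subset_iff)
qed

text \<open>
  The strip conditions become inequalities between parts. That the first partition is empty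
  is the case \<open>d = 0\<close> of the last clause.
\<close>

definition strip_chain :: "nat \<Rightarrow> (nat \<Rightarrow> nat) \<Rightarrow> (nat \<Rightarrow> nat \<Rightarrow> nat) \<Rightarrow> bool" where
  "strip_chain n mu f \<longleftrightarrow>
     (\<forall>d\<le>2*n. is_partition (f d)) \<and> f (2*n) = mu \<and>
     (\<forall>k<n. \<forall>i\<ge>1. f (2*k) i \<le> f (2*k+1) i \<and> f (2*k+1) (Suc i) \<le> f (2*k) i) \<and>
     (\<forall>k<n. \<forall>i\<ge>1. f (2*k+1) i \<le> f (2*k+2) i \<and> f (2*k+2) i \<le> Suc (f (2*k+1) i)) \<and>
     (\<forall>d\<le>2*n. \<forall>i>(d+1) div 2. f d i = 0)"

lemma case2_iff_strip_chain:
  "L \<in> case2_sequences (2*n+1) mu \<longleftrightarrow> length L = 2*n+1 \<and> strip_chain n mu ((!) L)"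
  (is "?lhs \<longleftrightarrow> ?rhs")
proof
  assume ?lhs
  then have len: "length L = 2*n+1" and part: "\<And>d. d \<le> 2*n \<Longrightarrow> is_partition (L ! d)"
    and hor: "\<And>k. 2*k+1 < 2*n+1 \<Longrightarrow> horizontal_skew (L ! (2*k+1)) (L ! (2*k))"
    and ver: "\<And>k. k \<ge> 1 \<Longrightarrow> 2*k < 2*n+1 \<Longrightarrow> vertical_skew (L ! (2*k)) (L ! (2*k-1))"
    and num: "\<And>d. d \<le> 2*n \<Longrightarrow> num_parts (L ! d) \<le> (d+1) div 2"
    and last: "L ! (2*n) = mu"
    by (auto simp: case2_sequences_def)
  have "(L ! (2*k)) i \<le> (L ! (2*k+1)) i \<and> (L ! (2*k+1)) (Suc i) \<le> (L ! (2*k)) i"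
    if "k < n" "i \<ge> 1" for k i
    using hor[of k] that part[of "2*k"] part[of "2*k+1"]
    by (simp add: horizontal_skew_iff_interlacing)
  moreover have "(L ! (2*k+1)) i \<le> (L ! (2*k+2)) i \<and> (L ! (2*k+2)) i \<le> Suc ((L ! (2*k+1)) i)"
    if "k < n" "i \<ge> 1" for k i
    using ver[of "k+1"] that by (simp add: vertical_skew_iff)
  moreover have "(L ! d) i = 0" if "d \<le> 2*n" "i > (d+1) div 2" for d i
    using num[of d] that num_parts_le_iff[OF part[of d]] by simp
  ultimately show ?rhs
    using len part last unfolding strip_chain_def by blast
next
  assume R: ?rhs
  then have len: "length L = 2*n+1" and part: "\<And>d. d \<le> 2*n \<Longrightarrow> is_partition (L ! d)"
    and hor: "\<And>k i. k < n \<Longrightarrow> i \<ge> 1 \<Longrightarrow>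
        (L ! (2*k)) i \<le> (L ! (2*k+1)) i \<and> (L ! (2*k+1)) (Suc i) \<le> (L ! (2*k)) i"
    and ver: "\<And>k i. k < n \<Longrightarrow> i \<ge> 1 \<Longrightarrow>
        (L ! (2*k+1)) i \<le> (L ! (2*k+2)) i \<and> (L ! (2*k+2)) i \<le> Suc ((L ! (2*k+1)) i)"
    and num: "\<And>d i. d \<le> 2*n \<Longrightarrow> i > (d+1) div 2 \<Longrightarrow> (L ! d) i = 0"
    and last: "L ! (2*n) = mu"
    unfolding strip_chain_def by blast+
  have "L ! 0 = (\<lambda>_. 0)"
  proof
    fix i show "(L ! 0) i = 0"
      using num[of 0 i] part[of 0] by (cases "i = 0") (simp_all add: is_partition_def)
  qed
  moreover have "horizontal_skew (L ! (2*k+1)) (L ! (2*k))" if "2*k+1 < 2*n+1" for k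
    using that hor[of k] part[of "2*k"] part[of "2*k+1"]
    by (simp add: horizontal_skew_iff_interlacing)
  moreover have "vertical_skew (L ! (2*k)) (L ! (2*k-1))" if "k \<ge> 1" "2*k < 2*n+1" for k
  proof -
    obtain k' where "k = Suc k'" using \<open>k \<ge> 1\<close> by (cases k) auto
    with that ver[of k'] show ?thesis by (simp add: vertical_skew_iff)
  qed
  moreover have "num_parts (L ! d) \<le> (d+1) div 2" if "d < 2*n+1" for d
    using num[of d] that part[of d] by (subst num_parts_le_iff) simp_all
  ultimately show ?lhs
    using len part last by (auto simp: case2_sequences_def)
qed

lemma strip_chain_step:
  assumes "strip_chain n mu f" "d < 2*n" "i \<ge> 1"
  shows "f d i \<le> f (Suc d) i"
proof (cases "even d")
  case True
  then obtain k where "d = 2*k" by (rule evenE)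
  with assms show ?thesis by (simp add: strip_chain_def)
next
  case False
  then obtain k where "d = 2*k+1" by (rule oddE)
  with assms show ?thesis by (simp add: strip_chain_def)
qed

lemma strip_chain_mono:
  assumes "strip_chain n mu f" "d \<le> e" "e \<le> 2*n" "i \<ge> 1"
  shows "f d i \<le> f e i"
  using assms(2,3)
proof (induction e rule: dec_induct)
  case (step e)
  then show ?case
    using strip_chain_step[OF assms(1), of e i] assms(4) by simp
qed simp

lemma case2_sequence_eqI:
  assumes "L \<in> case2_sequences (2*n+1) mu" "L' \<in> case2_sequences (2*n+1) mu"
    and "\<And>d i. d \<le> 2*n \<Longrightarrow> 1 \<le> i \<Longrightarrow> i \<le> (d+1) div 2 \<Longrightarrow> (L ! d) i = (L' ! d) i"
  shows "L = L'"
proof (rule nth_equalityI)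
  show "length L = length L'"
    using assms by (metis case2_iff_strip_chain)
  fix d assume "d < length L"
  then have d: "d \<le> 2*n"
    using assms(1) unfolding case2_iff_strip_chain by simp
  show "L ! d = L' ! d"
  proof
    fix i show "(L ! d) i = (L' ! d) i"
    proof (cases "1 \<le> i \<and> i \<le> (d+1) div 2")
      case False
      with d assms(1,2) have "(L ! d) i = 0" "(L' ! d) i = 0"
        unfolding case2_iff_strip_chain strip_chain_def is_partition_def
        by (metis less_one not_le)+
      then show ?thesis by simp
    qed (use assms(3) d in blast)
  qed
qed

lemma case2_sequenceI:
  assumes "strip_chain n mu f"
  shows "map f [0..<2*n+1] \<in> case2_sequences (2*n+1) mu"
proof -
  have [simp]: "map f [0..<2*n+1] ! d = f d" if "d \<le> 2*n" for d
    using that by (subst nth_map) (auto simp del: upt_Suc)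
  have "strip_chain n mu ((!) (map f [0..<2*n+1]))"
    using assms unfolding strip_chain_def
    by (simp del: upt_Suc map_upt_Suc)
  then show ?thesis
    unfolding case2_iff_strip_chain by simp
qed

section \<open>Sequences and tableaux\<close>

text \<open>The position of a letter in the alphabet, counted from 1, and its inverse.\<close>

fun letter_rank :: "letter \<Rightarrow> nat" where
  "letter_rank (Unbarred k) = 2*k - 1"
| "letter_rank (Barred k) = 2*k"

definition letter_of_rank :: "nat \<Rightarrow> letter" where
  "letter_of_rank d = (if even d then Barred (d div 2) else Unbarred ((d+1) div 2))"

lemma letter_of_rank_inverse: "1 \<le> idx x \<Longrightarrow> letter_of_rank (letter_rank x) = x"
  by (cases x) (auto simp: letter_of_rank_def)

lemma letter_rank_inverse: "1 \<le> d \<Longrightarrow> letter_rank (letter_of_rank d) = d"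
  by (auto simp: letter_of_rank_def elim!: evenE oddE)

lemma idx_letter_of_rank: "idx (letter_of_rank d) = (d+1) div 2"
  by (auto simp: letter_of_rank_def elim!: evenE oddE)

lemma idx_eq_rank: "idx x = (letter_rank x + 1) div 2"
  by (cases x) auto

lemma letter_rank_le_iff:
  "1 \<le> idx x \<Longrightarrow> 1 \<le> idx y \<Longrightarrow> letter_rank x \<le> letter_rank y \<longleftrightarrow> x \<le> y"
  by (cases x; cases y) (auto simp: less_eq_letter_def)

lemma letter_less_Unbarred_iff: "x < Unbarred (Suc n) \<longleftrightarrow> idx x \<le> n"
  by (cases x) (auto simp: less_letter_def)

lemma letter_rank_eq_iff:
  "1 \<le> idx x \<Longrightarrow> 1 \<le> idx y \<Longrightarrow> letter_rank x = letter_rank y \<longleftrightarrow> x = y"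
  by (metis letter_of_rank_inverse)

lemma finite_tableaux_below:
  assumes "is_partition mu"
  shows "finite (tableaux_below (Unbarred (n+1)) mu)"
proof (rule finite_subset)
  let ?A = "letter_of_rank ` {..2*n}"
  show "tableaux_below (Unbarred (n+1)) mu \<subseteq> young_diagram mu \<rightarrow>\<^sub>E ?A"
  proof
    fix T assume T: "T \<in> tableaux_below (Unbarred (n+1)) mu"
    then have ext: "T \<in> young_diagram mu \<rightarrow>\<^sub>E {x. 1 \<le> idx x}"
      by (simp add: tableaux_below_def super_symplectic_tableaux_def)
    have "T b \<in> ?A" if b: "b \<in> young_diagram mu" for b
    proof -
      have "1 \<le> idx (T b)" using PiE_mem[OF ext b] by simp
      moreover have "idx (T b) \<le> n"
        using T b by (simp add: tableaux_below_def letter_less_Unbarred_iff)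
      then have "letter_rank (T b) \<le> 2*n"
        by (cases "T b") auto
      ultimately show ?thesis
        by (metis imageI letter_of_rank_inverse atMost_iff)
    qed
    moreover have "T b = undefined" if "b \<notin> young_diagram mu" for b
      by (rule PiE_arb[OF ext that])
    ultimately show "T \<in> young_diagram mu \<rightarrow>\<^sub>E ?A" by (rule PiE_I)
  qed
  show "finite (young_diagram mu \<rightarrow>\<^sub>E ?A)"
    using finite_young_diagram[OF assms] by (rule finite_PiE) simp
qed

text \<open>
  A box receives the number of the first partition of the chain that contains it; conversely
  the partition numbered \<open>d\<close> consists of the boxes that carry one of the first \<open>d\<close> letters.
\<close>

definition level :: "(nat \<Rightarrow> nat) list \<Rightarrow> nat \<times> nat \<Rightarrow> nat" where
  "level L b = (LEAST d. b \<in> young_diagram (L ! d))"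

definition tableau_of_chain :: "(nat \<Rightarrow> nat) \<Rightarrow> (nat \<Rightarrow> nat) list \<Rightarrow> nat \<times> nat \<Rightarrow> letter" where
  "tableau_of_chain mu L = (\<lambda>b\<in>young_diagram mu. letter_of_rank (level L b))"

definition sublevel_partition ::
    "(nat \<Rightarrow> nat) \<Rightarrow> (nat \<times> nat \<Rightarrow> letter) \<Rightarrow> nat \<Rightarrow> nat \<Rightarrow> nat" where
  "sublevel_partition mu T d i = card {j. (i, j) \<in> young_diagram mu \<and> letter_rank (T (i, j)) \<le> d}"

context
  fixes n :: nat and mu :: "nat \<Rightarrow> nat"
begin

lemma level_le_iff:
  assumes L: "L \<in> case2_sequences (2*n+1) mu" and b: "b \<in> young_diagram mu" and d: "d \<le> 2*n"
  shows "level L b \<le> d \<longleftrightarrow> b \<in> young_diagram (L ! d)"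
proof -
  have c: "strip_chain n mu ((!) L)"
    using L unfolding case2_iff_strip_chain by blast
  have bn: "b \<in> young_diagram (L ! (2*n))"
    using c b by (simp add: strip_chain_def)
  have le: "level L b \<le> 2*n"
    unfolding level_def by (rule Least_le) (rule bn)
  have mem: "b \<in> young_diagram (L ! level L b)"
    unfolding level_def by (rule LeastI) (rule bn)
  show ?thesis
  proof
    assume "level L b \<le> d"
    with mem d show "b \<in> young_diagram (L ! d)"
      using strip_chain_mono[OF c, of "level L b" d "fst b"] by (cases b) auto
  next
    assume "b \<in> young_diagram (L ! d)"
    then show "level L b \<le> d" unfolding level_def by (rule Least_le)
  qed
qed

lemma level_bounds:
  assumes L: "L \<in> case2_sequences (2*n+1) mu" and b: "b \<in> young_diagram mu"
  shows "1 \<le> level L b" "level L b \<le> 2*n"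
proof -
  have "L ! 0 = (\<lambda>_. 0)" "L ! (2*n) = mu"
    using L by (simp_all add: case2_sequences_def)
  with b level_le_iff[OF L b, of 0] level_le_iff[OF L b, of "2*n"]
  show "1 \<le> level L b" "level L b \<le> 2*n"
    by (cases b; auto)+
qed

lemma tableau_of_chain_rank:
  assumes L: "L \<in> case2_sequences (2*n+1) mu" and b: "b \<in> young_diagram mu" and d: "d \<le> 2*n"
  shows "letter_rank (tableau_of_chain mu L b) \<le> d \<longleftrightarrow> b \<in> young_diagram (L ! d)"
proof -
  have "letter_rank (tableau_of_chain mu L b) = level L b"
    using level_bounds(1)[OF L b] b by (simp add: tableau_of_chain_def letter_rank_inverse)
  with level_le_iff[OF assms] show ?thesis by (simp only:)
qed

lemma tableau_of_chain_in:
  assumes mu: "is_partition mu" and L: "L \<in> case2_sequences (2*n+1) mu"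
  shows "tableau_of_chain mu L \<in> tableaux_below (Unbarred (n+1)) mu"
proof -
  let ?T = "tableau_of_chain mu L" and ?D = "young_diagram mu"
  have c: "strip_chain n mu ((!) L)"
    using L unfolding case2_iff_strip_chain by blast
  have part: "\<And>d. d \<le> 2*n \<Longrightarrow> is_partition (L ! d)"
    and num: "\<And>d i. d \<le> 2*n \<Longrightarrow> i > (d+1) div 2 \<Longrightarrow> (L ! d) i = 0"
    using c unfolding strip_chain_def by blast+
  have T: "?T b = letter_of_rank (level L b)" "1 \<le> idx (?T b)" "idx (?T b) \<le> n"
    "letter_rank (?T b) = level L b" if "b \<in> ?D" for b
    using that level_bounds[OF L that]
    by (auto simp: tableau_of_chain_def letter_rank_inverse idx_letter_of_rank)
  have mono: "?T b \<le> ?T b'"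
    if b: "b \<in> ?D" "b' \<in> ?D" and le: "fst b \<le> fst b'" "snd b \<le> snd b'" for b b'
  proof -
    have lv: "level L b' \<le> 2*n" using level_bounds[OF L b(2)] by simp
    then have "b' \<in> young_diagram (L ! level L b')"
      using level_le_iff[OF L b(2) lv] by simp
    then have "b \<in> young_diagram (L ! level L b')"
      using le b partition_antimono[OF part[OF lv], of "fst b" "fst b'"]
      by (cases b; cases b') auto
    then have "level L b \<le> level L b'"
      using level_le_iff[OF L b(1) lv] by simp
    with T[OF b(1)] T[OF b(2)] show ?thesis
      by (metis letter_rank_le_iff)
  qed
  have "horizontal_strip {b \<in> ?D. ?T b = Unbarred k}" if k: "1 \<le> k" for k
    unfolding horizontal_strip_def
  proof (intro ballI impI)
    fix b b' assume b: "b \<in> {b \<in> ?D. ?T b = Unbarred k}" "b' \<in> {b \<in> ?D. ?T b = Unbarred k}"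
      and eq: "snd b = snd b'"
    from b have bD: "b \<in> ?D" "b' \<in> ?D" by auto
    obtain k' where k': "k = Suc k'" using k by (cases k) auto
    have kn: "k' < n" using b T(3)[of b] k' by auto
    have lv: "level L b = 2*k'+1" "level L b' = 2*k'+1"
      using b T(4)[OF bD(1)] T(4)[OF bD(2)] k' by auto
    have H: "horizontal_skew (L ! (2*k'+1)) (L ! (2*k'))"
      using L kn by (auto simp: case2_sequences_def)
    have "b \<in> young_diagram (L ! (2*k'+1)) - young_diagram (L ! (2*k'))"
      "b' \<in> young_diagram (L ! (2*k'+1)) - young_diagram (L ! (2*k'))"
      using level_le_iff[OF L bD(1), of "2*k'"] level_le_iff[OF L bD(1), of "2*k'+1"]
        level_le_iff[OF L bD(2), of "2*k'"] level_le_iff[OF L bD(2), of "2*k'+1"] lv kn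
      by auto
    with H eq show "b = b'"
      unfolding horizontal_skew_def horizontal_strip_def by blast
  qed
  moreover have "vertical_strip {b \<in> ?D. ?T b = Barred k}" if k: "1 \<le> k" for k
    unfolding vertical_strip_def
  proof (intro ballI impI)
    fix b b' assume b: "b \<in> {b \<in> ?D. ?T b = Barred k}" "b' \<in> {b \<in> ?D. ?T b = Barred k}"
      and eq: "fst b = fst b'"
    from b have bD: "b \<in> ?D" "b' \<in> ?D" by auto
    have kn: "k \<le> n" using b T(3)[of b] by auto
    have lv: "level L b = 2*k" "level L b' = 2*k"
      using b T(4)[OF bD(1)] T(4)[OF bD(2)] by auto
    have less: "2*k-1 \<le> 2*n" using kn by simp
    have V: "vertical_skew (L ! (2*k)) (L ! (2*k-1))"
      using L kn k by (auto simp: case2_sequences_def)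
    have "b \<in> young_diagram (L ! (2*k)) - young_diagram (L ! (2*k-1))"
      "b' \<in> young_diagram (L ! (2*k)) - young_diagram (L ! (2*k-1))"
      using level_le_iff[OF L bD(1) less] level_le_iff[OF L bD(1), of "2*k"]
        level_le_iff[OF L bD(2) less] level_le_iff[OF L bD(2), of "2*k"] lv kn k
      by auto
    with V eq show "b = b'"
      unfolding vertical_skew_def vertical_strip_def by blast
  qed
  moreover have "i \<le> k"
    if b: "(i, j) \<in> ?D" and e: "?T (i, j) \<in> {Unbarred k, Barred k}" for i j k
  proof (rule ccontr)
    assume ik: "\<not> i \<le> k"
    have lv: "level L (i, j) \<le> 2*n" using level_bounds[OF L b] by simp
    have "(i, j) \<in> young_diagram (L ! level L (i, j))"
      using level_le_iff[OF L b lv] by simp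
    moreover have "(level L (i, j) + 1) div 2 = k"
      using T(1)[OF b] e idx_letter_of_rank[of "level L (i, j)"] by auto
    ultimately show False
      using num[OF lv, of i] ik b by auto
  qed
  moreover have "?T \<in> ?D \<rightarrow>\<^sub>E {x. 1 \<le> idx x}"
    using T(2) by (auto simp: tableau_of_chain_def)
  moreover have "\<forall>b\<in>?D. ?T b < Unbarred (n+1)"
    using T(3) by (simp add: letter_less_Unbarred_iff)
  moreover have "\<forall>i j j'. (i, j) \<in> ?D \<and> (i, j') \<in> ?D \<and> j \<le> j' \<longrightarrow> ?T (i, j) \<le> ?T (i, j')"
    "\<forall>i i' j. (i, j) \<in> ?D \<and> (i', j) \<in> ?D \<and> i \<le> i' \<longrightarrow> ?T (i, j) \<le> ?T (i', j)"
    by (intro allI impI mono; simp)+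
  ultimately show ?thesis
    unfolding tableaux_below_def super_symplectic_tableaux_def
    by (intro CollectI conjI) blast+
qed

lemma tableau_of_chain_inj: "inj_on (tableau_of_chain mu) (case2_sequences (2*n+1) mu)"
proof (rule inj_onI)
  fix L L' assume L: "L \<in> case2_sequences (2*n+1) mu" and L': "L' \<in> case2_sequences (2*n+1) mu"
    and eq: "tableau_of_chain mu L = tableau_of_chain mu L'"
  show "L = L'"
  proof (rule case2_sequence_eqI[OF L L'])
    fix d i :: nat assume d: "d \<le> 2*n" and i: "1 \<le> i"
    have sub: "young_diagram (M ! d) \<subseteq> young_diagram mu" if "M \<in> case2_sequences (2*n+1) mu" for M
    proof -
      have "strip_chain n mu ((!) M)" "M ! (2*n) = mu"
        using that unfolding case2_iff_strip_chain strip_chain_def by blast+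
      then show ?thesis
        using strip_chain_mono[of n mu "(!) M" d "2*n"] d
        by (auto simp: young_diagram_subset_iff)
    qed
    have "b \<in> young_diagram (L ! d) \<longleftrightarrow> b \<in> young_diagram (L' ! d)" if "b \<in> young_diagram mu" for b
      using tableau_of_chain_rank[OF L that d] tableau_of_chain_rank[OF L' that d] eq by simp
    with sub[OF L] sub[OF L'] have "young_diagram (L ! d) = young_diagram (L' ! d)"
      by blast
    with i show "(L ! d) i = (L' ! d) i"
      by (simp add: set_eq_subset young_diagram_subset_iff order_antisym)
  qed
qed

lemma sublevel_partition_diagram:
  assumes mu: "is_partition mu" and T: "T \<in> super_symplectic_tableaux mu"
  shows "young_diagram (sublevel_partition mu T d)
    = {b \<in> young_diagram mu. letter_rank (T b) \<le> d}" (is "_ = ?R")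
proof -
  have pos: "1 \<le> idx (T b)" if "b \<in> young_diagram mu" for b
    using T that by (auto simp: super_symplectic_tableaux_def dest: PiE_mem)
  have row: "\<exists>m. {j. (i, j) \<in> ?R} = {1..m}" for i
  proof -
    let ?J = "{j. (i, j) \<in> ?R}"
    have down: "j' \<in> ?J" if "j \<in> ?J" "1 \<le> j'" "j' \<le> j" for j j'
    proof -
      have D: "(i, j) \<in> young_diagram mu" "(i, j') \<in> young_diagram mu"
        using that by auto
      then have "T (i, j') \<le> T (i, j)"
        using T that(3) unfolding super_symplectic_tableaux_def by blast
      then have "letter_rank (T (i, j')) \<le> letter_rank (T (i, j))"
        using pos D by (simp add: letter_rank_le_iff)
      with that D show ?thesis by simp
    qed
    have fin: "finite ?J"
      by (rule finite_subset[of _ "{..mu i}"]) auto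
    show ?thesis
    proof (cases "?J = {}")
      case True
      then show ?thesis by (intro exI[of _ 0]) simp
    next
      case False
      have "?J = {1..Max ?J}"
      proof (intro set_eqI iffI)
        fix j assume "j \<in> ?J"
        with fin show "j \<in> {1..Max ?J}" by (auto intro: Max_ge)
      next
        fix j assume "j \<in> {1..Max ?J}"
        then show "j \<in> ?J" using down[OF Max_in[OF fin False], of j] by simp
      qed
      then show ?thesis by blast
    qed
  qed
  have "(i, j) \<in> young_diagram (sublevel_partition mu T d) \<longleftrightarrow> (i, j) \<in> ?R" for i j
  proof -
    obtain m where m: "{j. (i, j) \<in> ?R} = {1..m}" using row by blast
    have "sublevel_partition mu T d i = card {j. (i, j) \<in> ?R}"
      unfolding sublevel_partition_def by (rule arg_cong[of _ _ card]) auto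
    then have s: "sublevel_partition mu T d i = m" using m by simp
    have "(i, j) \<in> ?R \<longleftrightarrow> j \<in> {1..m}" using m by blast
    with s show ?thesis by auto
  qed
  then show ?thesis by (metis (no_types, lifting) set_eqI surj_pair)
qed

lemma sublevel_chain:
  assumes mu: "is_partition mu" and T: "T \<in> tableaux_below (Unbarred (n+1)) mu"
  shows "map (sublevel_partition mu T) [0..<2*n+1] \<in> case2_sequences (2*n+1) mu"
proof -
  let ?f = "sublevel_partition mu T" and ?D = "young_diagram mu"
  let ?L = "map ?f [0..<2*n+1]"
  have T': "T \<in> super_symplectic_tableaux mu" and below: "\<And>b. b \<in> ?D \<Longrightarrow> idx (T b) \<le> n"
    using T by (auto simp: tableaux_below_def letter_less_Unbarred_iff)
  note Y = sublevel_partition_diagram[OF mu T']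
  have pos: "1 \<le> idx (T b)" if "b \<in> young_diagram mu" for b
    using T' that by (auto simp: super_symplectic_tableaux_def dest: PiE_mem)
  have cond: "i \<le> k"
    if "1 \<le> k" "(i, j) \<in> ?D" "T (i, j) \<in> {Unbarred k, Barred k}" for i j k
    using T' that unfolding super_symplectic_tableaux_def by blast
  have col: "T (i, j) \<le> T (i', j)"
    if "(i, j) \<in> ?D" "(i', j) \<in> ?D" "i \<le> i'" for i i' j
    using T' that unfolding super_symplectic_tableaux_def by blast
  have zero: "?f d i = 0" if "i = 0 \<or> i > (d+1) div 2" for d i
  proof (cases "i = 0")
    case False
    show ?thesis
    proof (rule ccontr)
      assume "?f d i \<noteq> 0"
      with False have "(i, ?f d i) \<in> young_diagram (?f d)" by simp
      then have b: "(i, ?f d i) \<in> ?D" "letter_rank (T (i, ?f d i)) \<le> d"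
        unfolding Y by auto
      then have "idx (T (i, ?f d i)) \<le> (d+1) div 2"
        by (simp add: idx_eq_rank div_le_mono)
      moreover have "i \<le> idx (T (i, ?f d i))"
        by (rule cond[OF pos[OF b(1)] b(1)]) (cases "T (i, ?f d i)"; simp)
      ultimately show False using that False by simp
    qed
  qed (simp add: sublevel_partition_def)
  have dec: "?f d (Suc i) \<le> ?f d i" if i: "1 \<le> i" for d i
  proof (cases "?f d (Suc i) = 0")
    case False
    let ?j = "?f d (Suc i)"
    have "(Suc i, ?j) \<in> young_diagram (?f d)" using False by simp
    then have b: "(Suc i, ?j) \<in> ?D" "letter_rank (T (Suc i, ?j)) \<le> d"
      unfolding Y by auto
    then have bi: "(i, ?j) \<in> ?D"
      using i partition_antimono[OF mu, of i "Suc i"] by auto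
    then have "T (i, ?j) \<le> T (Suc i, ?j)"
      using col b(1) by simp
    then have "letter_rank (T (i, ?j)) \<le> letter_rank (T (Suc i, ?j))"
      using pos[OF bi] pos[OF b(1)] by (simp only: letter_rank_le_iff)
    with b have "letter_rank (T (i, ?j)) \<le> d" by simp
    with bi have "(i, ?j) \<in> young_diagram (?f d)" unfolding Y by auto
    then show ?thesis by simp
  qed simp
  have part: "is_partition (?f d)" for d
    by (rule is_partitionI[of _ "(d+1) div 2"]) (use zero dec in auto)
  have last: "?f (2*n) = mu"
  proof
    fix i
    have "letter_rank (T b) \<le> 2*n" if "b \<in> ?D" for b
      using below[OF that] by (cases "T b") auto
    then have "young_diagram (?f (2*n)) = ?D" unfolding Y by auto
    then have "\<forall>i\<ge>1. ?f (2*n) i = mu i"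
      by (simp add: set_eq_subset young_diagram_subset_iff order_antisym)
    then show "?f (2*n) i = mu i"
      using zero[of i "2*n"] mu by (cases "i = 0") (auto simp: is_partition_def)
  qed
  have first: "?f 0 = (\<lambda>_. 0)"
    using zero[of _ 0] by auto
  have "horizontal_skew (?f (2*k+1)) (?f (2*k))" for k
  proof -
    have "young_diagram (?f (2*k+1)) - young_diagram (?f (2*k)) \<subseteq> {b \<in> ?D. T b = Unbarred (k+1)}"
    proof
      fix b assume "b \<in> young_diagram (?f (2*k+1)) - young_diagram (?f (2*k))"
      then have "b \<in> ?D" "letter_rank (T b) = 2*k+1" unfolding Y by auto
      moreover from this have "T b = Unbarred (k+1)"
        using pos[of b] letter_rank_eq_iff[of "T b" "Unbarred (k+1)"] by simp
      ultimately show "b \<in> {b \<in> ?D. T b = Unbarred (k+1)}" by simp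
    qed
    moreover have "horizontal_strip {b \<in> ?D. T b = Unbarred (k+1)}"
      using T' unfolding super_symplectic_tableaux_def by simp
    ultimately have "horizontal_strip (young_diagram (?f (2*k+1)) - young_diagram (?f (2*k)))"
      unfolding horizontal_strip_def by blast
    then show ?thesis unfolding horizontal_skew_def by (auto simp: Y)
  qed
  moreover have "vertical_skew (?f (2*k)) (?f (2*k-1))" if k: "k \<ge> 1" for k
  proof -
    have "young_diagram (?f (2*k)) - young_diagram (?f (2*k-1)) \<subseteq> {b \<in> ?D. T b = Barred k}"
    proof
      fix b assume "b \<in> young_diagram (?f (2*k)) - young_diagram (?f (2*k-1))"
      then have "b \<in> ?D" "letter_rank (T b) = 2*k" using k unfolding Y by auto
      moreover from this have "T b = Barred k"
        using k pos[of b] letter_rank_eq_iff[of "T b" "Barred k"] by simp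
      ultimately show "b \<in> {b \<in> ?D. T b = Barred k}" by simp
    qed
    moreover have "vertical_strip {b \<in> ?D. T b = Barred k}"
      using T' k unfolding super_symplectic_tableaux_def by blast
    ultimately have "vertical_strip (young_diagram (?f (2*k)) - young_diagram (?f (2*k-1)))"
      unfolding vertical_strip_def by blast
    then show ?thesis unfolding vertical_skew_def by (auto simp: Y)
  qed
  moreover have "num_parts (?f d) \<le> (d+1) div 2" for d
    using zero by (subst num_parts_le_iff[OF part]) blast
  moreover have "?L ! d = ?f d" if "d < 2*n+1" for d
    using that by (subst nth_map) (auto simp del: upt_Suc)
  moreover have "length ?L = 2*n+1" by simp
  ultimately show ?thesis
    using part last first unfolding case2_sequences_def
    by (simp del: upt_Suc map_upt_Suc)
qed

lemma bij_betw_chains_tableaux: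
  assumes mu: "is_partition mu"
  shows "bij_betw (tableau_of_chain mu) (case2_sequences (2*n+1) mu)
    (tableaux_below (Unbarred (n+1)) mu)"
proof (rule bij_betwI')
  fix T assume T: "T \<in> tableaux_below (Unbarred (n+1)) mu"
  let ?L = "map (sublevel_partition mu T) [0..<2*n+1]"
  note L = sublevel_chain[OF mu T]
  have T': "T \<in> super_symplectic_tableaux mu"
    using T by (simp add: tableaux_below_def)
  have ext: "T \<in> young_diagram mu \<rightarrow>\<^sub>E {x. 1 \<le> idx x}"
    using T' by (simp add: super_symplectic_tableaux_def)
  have TL: "tableau_of_chain mu ?L \<in> tableaux_below (Unbarred (n+1)) mu"
    by (rule tableau_of_chain_in[OF mu L])
  have ext': "tableau_of_chain mu ?L \<in> young_diagram mu \<rightarrow>\<^sub>E {x. 1 \<le> idx x}"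
    using TL by (simp add: super_symplectic_tableaux_def tableaux_below_def)
  have "T b = tableau_of_chain mu ?L b" if b: "b \<in> young_diagram mu" for b
  proof -
    have iff: "letter_rank (tableau_of_chain mu ?L b) \<le> d \<longleftrightarrow> letter_rank (T b) \<le> d"
      if d: "d \<le> 2*n" for d
    proof -
      have "?L ! d = sublevel_partition mu T d"
        using d by (subst nth_map) (auto simp del: upt_Suc)
      then show ?thesis
        unfolding tableau_of_chain_rank[OF L b d]
        using sublevel_partition_diagram[OF mu T', of d] b by simp
    qed
    have "letter_rank (S b) \<le> 2*n" if "S \<in> tableaux_below (Unbarred (n+1)) mu" for S
    proof -
      have "idx (S b) \<le> n"
        using b that by (simp add: tableaux_below_def letter_less_Unbarred_iff)
      then show ?thesis by (cases "S b") auto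
    qed
    from iff[OF this[OF T]] iff[OF this[OF TL]]
    have "letter_rank (T b) = letter_rank (tableau_of_chain mu ?L b)"
      by simp
    then show ?thesis
      using PiE_mem[OF ext b] PiE_mem[OF ext' b] letter_rank_eq_iff by auto
  qed
  then have "T = tableau_of_chain mu ?L"
    using ext ext' by (intro PiE_ext)
  with L show "\<exists>L\<in>case2_sequences (2*n+1) mu. T = tableau_of_chain mu L" by blast
qed (use tableau_of_chain_in[OF mu] inj_on_eq_iff[OF tableau_of_chain_inj] in auto)

end

section \<open>Sequences and lattice paths\<close>

text \<open>
  A Delannoy path visits on each line \<open>y = h\<close> an interval of points, and the first point of
  the next line lies above the last point of this interval or one step to the right of it.
  So a path is given by the abscissas \<open>e h\<close> and \<open>l h\<close> of its first and last points at
  height \<open>h\<close>.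
\<close>

definition run_path :: "(int \<Rightarrow> int) \<Rightarrow> (int \<Rightarrow> int) \<Rightarrow> int \<Rightarrow> int \<Rightarrow> (int \<times> int) list" where
  "run_path e l y z = concat (map (\<lambda>h. map (\<lambda>x. (x, h)) [e h..l h]) [y..z])"

definition runs :: "(int \<Rightarrow> int) \<Rightarrow> (int \<Rightarrow> int) \<Rightarrow> int \<Rightarrow> int \<Rightarrow> bool" where
  "runs e l y z \<longleftrightarrow>
     (\<forall>h\<in>{y..z}. e h \<le> l h) \<and> (\<forall>h\<in>{y..<z}. e (h+1) = l h \<or> e (h+1) = l h + 1)"

lemma set_run_path: "set (run_path e l y z) = {(x, h). y \<le> h \<and> h \<le> z \<and> e h \<le> x \<and> x \<le> l h}"
  by (auto simp: run_path_def)

lemma run_path_Cons: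
  "y \<le> z \<Longrightarrow> run_path e l y z = map (\<lambda>x. (x, y)) [e y..l y] @ run_path e l (y+1) z"
  by (simp add: run_path_def upto_rec1)

lemma run_path_cong:
  "(\<And>h. y \<le> h \<Longrightarrow> h \<le> z \<Longrightarrow> e h = e' h \<and> l h = l' h) \<Longrightarrow>
    run_path e l y z = run_path e' l' y z"
  unfolding run_path_def by (intro arg_cong[of _ _ concat] map_cong) auto

lemma run_path_empty [simp]: "z < y \<Longrightarrow> run_path e l y z = []"
  by (simp add: run_path_def)

lemma upto_ends:
  fixes a b :: int
  assumes "a \<le> b"
  shows "[a..b] \<noteq> []" "hd [a..b] = a" "last [a..b] = b"
proof -
  show "[a..b] \<noteq> []" "hd [a..b] = a"
    using assms by (simp_all add: upto_rec1)
  show "last [a..b] = b"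
    using assms by (simp add: upto_rec2)
qed

lemma horizontal_run_successively:
  "successively delannoy_step (map (\<lambda>x. (x, h)) [a..b])"
proof (induction a b rule: upto.induct)
  case (1 a b)
  show ?case
  proof (cases "a < b")
    case True
    then have "[a..b] = a # (a+1) # [a+1+1..b]"
      using upto_rec1[of a b] upto_rec1[of "a+1" b] by simp
    moreover have "[a+1..b] = (a+1) # [a+1+1..b]"
      using True upto_rec1[of "a+1" b] by simp
    ultimately show ?thesis
      using 1 True by (simp add: delannoy_step_def)
  qed (cases "a = b"; simp)
qed

lemma run_path_is_delannoy:
  assumes "y \<le> z" "runs e l y z"
  shows "run_path e l y z \<noteq> [] \<and> hd (run_path e l y z) = (e y, y) \<and>
    last (run_path e l y z) = (l z, z) \<and> successively delannoy_step (run_path e l y z)"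
  using assms
proof (induction y rule: int_le_induct)
  case base
  then have "e z \<le> l z" by (simp add: runs_def)
  then have "run_path e l z z \<noteq> []" "hd (run_path e l z z) = (e z, z)"
    "last (run_path e l z z) = (l z, z)"
    by (simp_all add: upto_ends run_path_Cons hd_map last_map)
  then show ?case
    using horizontal_run_successively by (simp add: run_path_Cons)
next
  case (step y)
  have sub: "runs e l y z" and le: "e (y-1) \<le> l (y-1)"
    and st: "e y = l (y-1) \<or> e y = l (y-1) + 1"
    using step.prems step.hyps by (auto simp: runs_def dest: bspec[of _ _ "y-1"])
  note IH = step.IH[OF sub]
  note row = upto_ends[OF le]
  have eq: "run_path e l (y-1) z
    = map (\<lambda>x. (x, y-1)) [e (y-1)..l (y-1)] @ run_path e l y z"
    using step.hyps run_path_Cons[of "y-1" z] by simp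
  show ?case
    unfolding eq using IH row st horizontal_run_successively
    by (auto simp: successively_append_iff hd_append last_append hd_map last_map delannoy_step_def)
qed

lemma delannoy_path_as_runs:
  assumes "p \<noteq> []" "successively delannoy_step p"
  shows "\<exists>e l. snd (hd p) \<le> snd (last p) \<and> runs e l (snd (hd p)) (snd (last p)) \<and>
    p = run_path e l (snd (hd p)) (snd (last p)) \<and>
    e (snd (hd p)) = fst (hd p) \<and> l (snd (last p)) = fst (last p)"
  using assms
proof (induction p)
  case (Cons u q)
  obtain x h where u: "u = (x, h)" by (cases u)
  show ?case
  proof (cases "q = []")
    case True
    have "run_path (\<lambda>_. x) (\<lambda>_. x) h h = [(x, h)]"
      by (simp add: run_path_Cons)
    with True u show ?thesis
      by (intro exI[of _ "\<lambda>_. x"]) (simp add: runs_def)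
  next
    case False
    let ?z = "snd (last q)"
    obtain x' h' where v: "hd q = (x', h')" by (cases "hd q")
    have step: "delannoy_step u (hd q)" and succ: "successively delannoy_step q"
      using Cons.prems False by (auto simp: successively_Cons)
    obtain e l where le: "h' \<le> ?z" and r: "runs e l h' ?z" and q: "q = run_path e l h' ?z"
      and ends: "e h' = x'" "l ?z = fst (last q)"
      using Cons.IH[OF False succ] v by auto
    from step u v consider "x' = x + 1" "h' = h" | "x' = x \<or> x' = x + 1" "h' = h + 1"
      by (auto simp: delannoy_step_def)
    then show ?thesis
    proof cases
      case 1
      let ?e = "e(h := x)"
      have r': "runs ?e l h ?z"
        unfolding runs_def
      proof (intro conjI ballI)
        fix k assume "k \<in> {h..?z}"
        with r 1 ends show "?e k \<le> l k" by (auto simp: runs_def dest: bspec[of _ _ k])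
      next
        fix k assume "k \<in> {h..<?z}"
        with r 1 ends show "?e (k+1) = l k \<or> ?e (k+1) = l k + 1" by (auto simp: runs_def)
      qed
      have "e h' \<le> l h'" using r le by (simp add: runs_def)
      with 1 ends have "x + 1 \<le> l h" by simp
      then have "[x..l h] = x # [x+1..l h]" by (simp add: upto_rec1)
      moreover have "run_path ?e l (h+1) ?z = run_path e l (h+1) ?z"
        by (rule run_path_cong) simp
      ultimately have "run_path ?e l h ?z = u # q"
        using le 1 ends u by (subst q) (simp add: run_path_Cons[of h])
      then show ?thesis
        using r' le 1 ends u False by - (rule exI[of _ ?e], rule exI[of _ l], simp add: fun_upd_def)
    next
      case 2
      let ?e = "e(h := x)" and ?l = "l(h := x)"
      have r': "runs ?e ?l h ?z"
        unfolding runs_def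
      proof (intro conjI ballI)
        fix k assume "k \<in> {h..?z}"
        with r 2 ends show "?e k \<le> ?l k" by (auto simp: runs_def)
      next
        fix k assume "k \<in> {h..<?z}"
        with r 2 ends show "?e (k+1) = ?l k \<or> ?e (k+1) = ?l k + 1" by (auto simp: runs_def)
      qed
      have "run_path ?e ?l (h+1) ?z = run_path e l (h+1) ?z"
        by (rule run_path_cong) simp
      then have "run_path ?e ?l h ?z = u # q"
        using le 2 ends u by (subst q) (simp add: run_path_Cons[of h])
      then show ?thesis
        using r' le 2 ends u False by - (rule exI[of _ ?e], rule exI[of _ ?l], simp add: fun_upd_def)
    qed
  qed
qed simp

text \<open>
  The last step of an H-Delannoy path is not an east step, which means that its run at the
  final height consists of a single point.
\<close>

lemma h_delannoy_path_iff:
  assumes "y < z"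
  shows "p \<in> h_delannoy_paths (a, y) (b, z) \<longleftrightarrow>
    (\<exists>e l. runs e l y z \<and> p = run_path e l y z \<and> e y = a \<and> e z = b \<and> l z = b)"
proof
  assume p: "p \<in> h_delannoy_paths (a, y) (b, z)"
  then obtain e l where el: "runs e l y z" "p = run_path e l y z" "e y = a" "l z = b"
    using delannoy_path_as_runs[of p] by (auto simp: h_delannoy_paths_def)
  moreover have "e z = b"
  proof (rule ccontr)
    assume "e z \<noteq> b"
    moreover have "e z \<le> l z" using el(1) assms by (simp add: runs_def)
    ultimately have "(b-1, z) \<in> set p"
      using el assms by (simp add: set_run_path)
    with p show False by (simp add: h_delannoy_paths_def)
  qed
  ultimately show "\<exists>e l. runs e l y z \<and> p = run_path e l y z \<and> e y = a \<and> e z = b \<and> l z = b"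
    by blast
next
  assume "\<exists>e l. runs e l y z \<and> p = run_path e l y z \<and> e y = a \<and> e z = b \<and> l z = b"
  then show "p \<in> h_delannoy_paths (a, y) (b, z)"
    using run_path_is_delannoy[of y z] assms by (force simp: h_delannoy_paths_def set_run_path)
qed

lemma run_path_inject:
  assumes "runs e l y z" "runs e' l' y z" "run_path e l y z = run_path e' l' y z" "y \<le> h" "h \<le> z"
  shows "e h = e' h \<and> l h = l' h"
proof -
  have "(x, h) \<in> set (run_path e l y z) \<longleftrightarrow> (x, h) \<in> set (run_path e' l' y z)" for x
    using assms(3) by simp
  then have "e h \<le> x \<and> x \<le> l h \<longleftrightarrow> e' h \<le> x \<and> x \<le> l' h" for x
    using assms(4,5) by (simp add: set_run_path)
  moreover have "e h \<le> l h" "e' h \<le> l' h"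
    using assms by (simp_all add: runs_def)
  ultimately show ?thesis by (metis order_antisym order_refl)
qed

text \<open>
  The \<open>i\<close>-th path records the growth of the \<open>i\<close>-th part, shifted by \<open>i\<close>: the horizontal strip
  added in step \<open>2 * h - 1\<close> contributes the east steps at height \<open>h\<close>, and the vertical strip
  added in step \<open>2 * h\<close> decides between a north and a northeast step. There is no horizontal
  strip at the final height, whence the minimum in the index of the last point.
\<close>

definition first_at :: "(nat \<Rightarrow> nat \<Rightarrow> nat) \<Rightarrow> nat \<Rightarrow> int \<Rightarrow> int" where
  "first_at f i y = int (f (2 * nat (y-1)) i) - int i"

definition last_at :: "nat \<Rightarrow> (nat \<Rightarrow> nat \<Rightarrow> nat) \<Rightarrow> nat \<Rightarrow> int \<Rightarrow> int" where
  "last_at n f i y = int (f (min (2 * nat (y-1) + 1) (2*n)) i) - int i"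

definition paths_of_chain :: "nat \<Rightarrow> (nat \<Rightarrow> nat) list \<Rightarrow> nat \<Rightarrow> (int \<times> int) list" where
  "paths_of_chain n L =
     (\<lambda>i\<in>{1..n}. run_path (first_at ((!) L) i) (last_at n ((!) L) i) (int i) (int n + 1))"

lemma runs_of_chain:
  assumes f: "strip_chain n mu f" and i: "1 \<le> i" "i \<le> n"
  shows "runs (first_at f i) (last_at n f i) (int i) (int n + 1)"
  unfolding runs_def
proof (intro conjI ballI)
  fix y assume y: "y \<in> {int i..int n + 1}"
  have "2 * nat (y-1) \<le> 2*n" using y by auto
  then have "f (2 * nat (y-1)) i \<le> f (min (2 * nat (y-1) + 1) (2*n)) i"
    by (intro strip_chain_mono[OF f]) (use i in auto)
  then show "first_at f i y \<le> last_at n f i y"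
    by (simp add: first_at_def last_at_def)
next
  fix y assume y: "y \<in> {int i..<int n + 1}"
  define k where "k = nat (y-1)"
  have k: "y = int k + 1" "k < n" using y i by (auto simp: k_def)
  have "f (2*k+1) i \<le> f (2*k+2) i" "f (2*k+2) i \<le> Suc (f (2*k+1) i)"
    using f k i unfolding strip_chain_def by blast+
  moreover have "min (Suc (2*k)) (2*n) = 2*k+1" "nat (1 + int k) = k+1" using k by auto
  ultimately show "first_at f i (y+1) = last_at n f i y \<or> first_at f i (y+1) = last_at n f i y + 1"
    by (auto simp: first_at_def last_at_def k(1) nat_add_distrib)
qed

lemma paths_of_chain_in:
  assumes L: "L \<in> case2_sequences (2*n+1) mu"
  shows "paths_of_chain n L \<in> nonintersecting_h_delannoy n mu"
proof -
  define f where "f = (!) L"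
  have f: "strip_chain n mu f"
    using L unfolding case2_iff_strip_chain f_def by blast
  have part: "\<And>d. d \<le> 2*n \<Longrightarrow> is_partition (f d)"
    and hor: "\<And>k i. k < n \<Longrightarrow> i \<ge> 1 \<Longrightarrow> f (2*k+1) (Suc i) \<le> f (2*k) i"
    and num: "\<And>d i. d \<le> 2*n \<Longrightarrow> i > (d+1) div 2 \<Longrightarrow> f d i = 0"
    and last: "f (2*n) = mu"
    using f unfolding strip_chain_def by blast+
  let ?P = "\<lambda>i. run_path (first_at f i) (last_at n f i) (int i) (int n + 1)"
  have path: "?P i \<in> h_delannoy_paths (- int i, int i) (int (mu i) - int i, int n + 1)"
    if i: "i \<in> {1..n}" for i
  proof -
    have "f (2 * nat (int i - 1)) i = 0"
      by (rule num) (use i in auto)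
    then have "first_at f i (int i) = - int i"
      by (simp add: first_at_def)
    moreover have "first_at f i (int n + 1) = int (mu i) - int i"
      "last_at n f i (int n + 1) = int (mu i) - int i"
      by (simp_all add: first_at_def last_at_def last)
    moreover have "int i < int n + 1" using i by simp
    ultimately show ?thesis
      using runs_of_chain[OF f, of i] i by (subst h_delannoy_path_iff) auto
  qed
  have disj: "set (?P i) \<inter> set (?P j) = {}" if i: "1 \<le> i" "i < j" "j \<le> n" for i j
  proof (rule ccontr)
    assume "set (?P i) \<inter> set (?P j) \<noteq> {}"
    then obtain x y where y: "int j \<le> y" "y \<le> int n + 1"
      and x: "first_at f i y \<le> x" "x \<le> last_at n f j y"
      by (auto simp: set_run_path)
    define k where "k = nat (y-1)"
    have k: "y = int k + 1" "k \<le> n" using y i by (auto simp: k_def)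
    have "f (min (2*k+1) (2*n)) j \<le> f (2*k) i"
    proof (cases "k < n")
      case True
      obtain j' where j': "j = Suc j'" using i by (cases j) auto
      have "f (2*k+1) j \<le> f (2*k) j'"
        using hor[OF True, of j'] i j' by simp
      also have "\<dots> \<le> f (2*k) i"
        using partition_antimono[OF part, of "2*k" i j'] True i j' by simp
      finally show ?thesis using True by (simp add: min_def)
    next
      case False
      with k have "k = n" by simp
      then show ?thesis
        using partition_antimono[OF part[of "2*n"], of i j] i by simp
    qed
    with x i show False
      by (simp add: first_at_def last_at_def k(1))
  qed
  have "set (?P i) \<inter> set (?P j) = {}" if "i \<in> {1..n}" "j \<in> {1..n}" "i \<noteq> j" for i j
    using that disj[of i j] disj[of j i] by (cases i j rule: linorder_cases) auto
  with path show ?thesis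
    by (auto simp: nonintersecting_h_delannoy_def paths_of_chain_def f_def)
qed

lemma paths_of_chain_inj: "inj_on (paths_of_chain n) (case2_sequences (2*n+1) mu)"
proof (rule inj_onI)
  fix L L' assume L: "L \<in> case2_sequences (2*n+1) mu" and L': "L' \<in> case2_sequences (2*n+1) mu"
    and eq: "paths_of_chain n L = paths_of_chain n L'"
  have c: "strip_chain n mu ((!) L)" "strip_chain n mu ((!) L')"
    using L L' unfolding case2_iff_strip_chain by blast+
  show "L = L'"
  proof (rule case2_sequence_eqI[OF L L'])
    fix d i :: nat assume d: "d \<le> 2*n" and i: "1 \<le> i" "i \<le> (d+1) div 2"
    have i': "i \<le> n" using d i by linarith
    let ?y = "int (d div 2) + 1"
    have "paths_of_chain n L i = paths_of_chain n L' i" using eq by simp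
    then have "first_at ((!) L) i ?y = first_at ((!) L') i ?y \<and>
        last_at n ((!) L) i ?y = last_at n ((!) L') i ?y"
      using i i' d
      by (intro run_path_inject[OF runs_of_chain[OF c(1)] runs_of_chain[OF c(2)]])
        (auto simp: paths_of_chain_def)
    then show "(L ! d) i = (L' ! d) i"
      using d by (cases "even d") (auto simp: first_at_def last_at_def elim!: evenE oddE)
  qed
qed

text \<open>
  Conversely, disjoint paths keep the order from right to left in which they enter: where
  path \<open>i + 1\<close> starts, path \<open>i\<close> is already further right, and a single step cannot jump over
  a path.
\<close>

lemma disjoint_runs_ordered:
  assumes r: "runs e l y0 z" "runs e' l' y0 z"
    and disj: "\<And>x h. y0 \<le> h \<Longrightarrow> h \<le> z \<Longrightarrow> e h \<le> x \<Longrightarrow> x \<le> l h \<Longrightarrow> e' h \<le> x \<Longrightarrow> x \<le> l' h \<Longrightarrow> False"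
    and start: "e' y0 < e y0" and y: "y0 \<le> y" "y \<le> z"
  shows "l' y < e y"
  using y
proof (induction y rule: int_ge_induct)
  case base
  then show ?case
    using start disj[of y0 "e y0"] r by (force simp: runs_def)
next
  case (step y)
  have a: "e' (y+1) = l' y \<or> e' (y+1) = l' y + 1" "e (y+1) = l y \<or> e (y+1) = l y + 1"
    "e y \<le> l y" "e (y+1) \<le> l (y+1)" "e' (y+1) \<le> l' (y+1)"
    using r step.prems step.hyps by (simp_all add: runs_def)
  then have "e' (y+1) \<le> e (y+1)" using step by auto
  then show ?case
    using a disj[of "y+1" "e (y+1)"] step.prems step.hyps by force
qed

lemma paths_of_chain_surj:
  assumes mu: "is_partition mu" "num_parts mu \<le> n"
    and p: "p \<in> nonintersecting_h_delannoy n mu"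
  shows "\<exists>L\<in>case2_sequences (2*n+1) mu. p = paths_of_chain n L"
proof -
  have ext: "p \<in> extensional {1..n}"
    and mem: "\<And>i. i \<in> {1..n} \<Longrightarrow>
      p i \<in> h_delannoy_paths (- int i, int i) (int (mu i) - int i, int n + 1)"
    and disj: "\<And>i j. i \<in> {1..n} \<Longrightarrow> j \<in> {1..n} \<Longrightarrow> i \<noteq> j \<Longrightarrow> set (p i) \<inter> set (p j) = {}"
    using p by (auto simp: nonintersecting_h_delannoy_def PiE_def)
  have "\<forall>i\<in>{1..n}. \<exists>e l. runs e l (int i) (int n + 1) \<and> p i = run_path e l (int i) (int n + 1) \<and>
      e (int i) = - int i \<and> e (int n + 1) = int (mu i) - int i \<and> l (int n + 1) = int (mu i) - int i"
  proof
    fix i assume i: "i \<in> {1..n}"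
    then have "int i < int n + 1" by simp
    from h_delannoy_path_iff[OF this] mem[OF i]
    show "\<exists>e l. runs e l (int i) (int n + 1) \<and> p i = run_path e l (int i) (int n + 1) \<and>
      e (int i) = - int i \<and> e (int n + 1) = int (mu i) - int i \<and> l (int n + 1) = int (mu i) - int i"
      by blast
  qed
  then obtain e l where r: "\<And>i. i \<in> {1..n} \<Longrightarrow> runs (e i) (l i) (int i) (int n + 1)"
    and pr: "\<And>i. i \<in> {1..n} \<Longrightarrow> p i = run_path (e i) (l i) (int i) (int n + 1)"
    and start: "\<And>i. i \<in> {1..n} \<Longrightarrow> e i (int i) = - int i"
    and stop: "\<And>i. i \<in> {1..n} \<Longrightarrow> e i (int n + 1) = int (mu i) - int i"
      "\<And>i. i \<in> {1..n} \<Longrightarrow> l i (int n + 1) = int (mu i) - int i"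
    by metis
  have el: "e i y \<le> l i y" if "i \<in> {1..n}" "int i \<le> y" "y \<le> int n + 1" for i y
    using r[OF that(1)] that by (simp add: runs_def)
  have le: "e i (y+1) = l i y \<or> e i (y+1) = l i y + 1"
    if "i \<in> {1..n}" "int i \<le> y" "y \<le> int n" for i y
    using r[OF that(1)] that by (simp add: runs_def)
  have lower: "- int i \<le> e i y" if i: "i \<in> {1..n}" and y: "int i \<le> y" "y \<le> int n + 1" for i y
    using y
  proof (induction y rule: int_ge_induct)
    case (step y)
    then show ?case using el[OF i, of y] le[OF i, of y] by auto
  qed (simp add: start[OF i])
  have order: "l (Suc i) y < e i y"
    if i: "1 \<le> i" "i < n" and y: "int (Suc i) \<le> y" "y \<le> int n + 1" for i y
  proof (rule disjoint_runs_ordered[where e = "e i" and l = "l i" and e' = "e (Suc i)"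
        and l' = "l (Suc i)" and ?y0.0 = "int (Suc i)" and z = "int n + 1"])
    show "runs (e i) (l i) (int (Suc i)) (int n + 1)"
      using r[of i] i by (simp add: runs_def)
    show "runs (e (Suc i)) (l (Suc i)) (int (Suc i)) (int n + 1)"
      using r[of "Suc i"] i by simp
    show "e (Suc i) (int (Suc i)) < e i (int (Suc i))"
      using start[of "Suc i"] lower[of i "int (Suc i)"] i by simp
    fix x h assume "int (Suc i) \<le> h" "h \<le> int n + 1" "e i h \<le> x" "x \<le> l i h"
      "e (Suc i) h \<le> x" "x \<le> l (Suc i) h"
    then have "(x, h) \<in> set (p i) \<inter> set (p (Suc i))"
      using i pr[of i] pr[of "Suc i"] by (simp add: set_run_path)
    then show False using disj[of i "Suc i"] i by auto
  qed (use y in auto)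
  \<comment> \<open>By \<open>lower\<close> nothing is truncated by \<open>nat\<close>.\<close>
  define f where "f d i = (if 1 \<le> i \<and> i \<le> (d+1) div 2 \<and> i \<le> n then
      nat ((if even d then e i (int (d div 2) + 1) else l i (int (d div 2) + 1)) + int i) else 0)"
    for d i
  \<comment> \<open>Path \<open>k + 1\<close> starts at height \<open>k + 1\<close>, where its part is 0: this agrees with the default
    value of \<open>f (2*k)\<close>, which has only \<open>k\<close> parts.\<close>
  have even_f: "int (f (2*k) i) - int i = e i (int k + 1)" if "1 \<le> i" "i \<le> k + 1" "i \<le> n" "k \<le> n" for k i
  proof (cases "i = k + 1")
    case True
    then show ?thesis using that start[of i] by (simp add: f_def add.commute)
  next
    case False
    then show ?thesis using that lower[of i "int k + 1"] by (simp add: f_def)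
  qed
  have odd_f: "int (f (2*k+1) i) - int i = l i (int k + 1)" if "1 \<le> i" "i \<le> k + 1" "i \<le> n" "k < n" for k i
    using that lower[of i "int k + 1"] el[of i "int k + 1"] by (simp add: f_def)
  have zero: "f d i = 0" if "i = 0 \<or> i > (d+1) div 2" for d i
    using that by (auto simp: f_def)
  have f_last: "f (2*n) = mu"
  proof
    fix i show "f (2*n) i = mu i"
    proof (cases "1 \<le> i \<and> i \<le> n")
      case True
      then show ?thesis using even_f[of i n] stop[of i] by simp
    next
      case False
      then have "mu i = 0"
        using mu by (cases "i = 0") (auto simp: num_parts_le_iff is_partition_def)
      with False show ?thesis using zero[of i "2*n"] by (cases "i = 0") auto
    qed
  qed
  have hor: "f (2*k) i \<le> f (2*k+1) i" "f (2*k+1) (Suc i) \<le> f (2*k) i" if k: "k < n" and i: "i \<ge> 1" for k i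
  proof -
    show "f (2*k) i \<le> f (2*k+1) i"
    proof (cases "i \<le> k + 1")
      case True
      then show ?thesis
        using even_f[of i k] odd_f[of i k] el[of i "int k + 1"] k i by simp
    qed (use zero in simp)
    show "f (2*k+1) (Suc i) \<le> f (2*k) i"
    proof (cases "i \<le> k")
      case True
      then show ?thesis
        using even_f[of i k] odd_f[of "Suc i" k] order[of i "int k + 1"] k i by simp
    qed (use zero in simp)
  qed
  have ver: "f (2*k+1) i \<le> f (2*k+2) i \<and> f (2*k+2) i \<le> Suc (f (2*k+1) i)" if k: "k < n" and i: "i \<ge> 1" for k i
  proof (cases "i \<le> k + 1")
    case True
    then show ?thesis
      using even_f[of i "k+1"] odd_f[of i k] le[of i "int k + 1"] k i by (auto simp: algebra_simps)
  next
    case False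
    then show ?thesis
      using zero[of i "2*k+1"] zero[of i "2*k+2"] by simp
  qed
  have dec: "f d (Suc i) \<le> f d i" if d: "d \<le> 2*n" and i: "1 \<le> i" for d i
  proof (cases "even d")
    case True
    then obtain k where k: "d = 2*k" by (rule evenE)
    show ?thesis
    proof (cases "k = n")
      case True
      then show ?thesis
        using k f_last mu i by (simp add: is_partition_def)
    next
      case False
      with k d i show ?thesis
        using hor(1)[of k "Suc i"] hor(2)[of k i] by simp
    qed
  next
    case False
    then obtain k where "d = 2*k+1" by (rule oddE)
    with d i show ?thesis
      using hor(1)[of k i] hor(2)[of k i] by simp
  qed
  have "is_partition (f d)" if "d \<le> 2*n" for d
    by (rule is_partitionI[of _ "(d+1) div 2"]) (use zero dec that in auto)
  with hor ver zero f_last have chain: "strip_chain n mu f"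
    unfolding strip_chain_def by blast
  let ?L = "map f [0..<2*n+1]"
  have nth: "?L ! d = f d" if "d \<le> 2*n" for d
    using that by (subst nth_map) (auto simp del: upt_Suc)
  have "p i = run_path (first_at ((!) ?L) i) (last_at n ((!) ?L) i) (int i) (int n + 1)"
    if i: "i \<in> {1..n}" for i
    unfolding pr[OF i]
  proof (rule run_path_cong)
    fix y assume y: "int i \<le> y" "y \<le> int n + 1"
    define k where "k = nat (y-1)"
    have k: "y = int k + 1" "k \<le> n" "i \<le> k + 1" using y i by (auto simp: k_def)
    have "e i y = first_at ((!) ?L) i y"
      using even_f[of i k] k i nth[of "2*k"] by (simp add: first_at_def del: upt_Suc)
    moreover have "l i y = last_at n ((!) ?L) i y"
    proof (cases "k < n")
      case True
      then have "min (2*k+1) (2*n) = 2*k+1" by simp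
      with True show ?thesis
        using odd_f[of i k] k i nth[of "2*k+1"] by (simp add: last_at_def del: upt_Suc)
    next
      case False
      with k have "k = n" by simp
      then show ?thesis
        using f_last stop(2)[OF i] k nth[of "2*n"] by (simp add: last_at_def del: upt_Suc)
    qed
    ultimately show "e i y = first_at ((!) ?L) i y \<and> l i y = last_at n ((!) ?L) i y" by blast
  qed
  with ext have "p = paths_of_chain n ?L"
    unfolding paths_of_chain_def by (intro extensionalityI[of p "{1..n}"]) auto
  with case2_sequenceI[OF chain] show ?thesis by blast
qed

lemma bij_betw_chains_paths:
  assumes "is_partition mu" "num_parts mu \<le> n"
  shows "bij_betw (paths_of_chain n) (case2_sequences (2*n+1) mu) (nonintersecting_h_delannoy n mu)"
  unfolding bij_betw_def
  using paths_of_chain_inj paths_of_chain_in paths_of_chain_surj[OF assms] by blast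

section \<open>Partitions as particle configurations\<close>

text \<open>
  The beta-set of a partition with at most \<open>m\<close> parts: the parts are made distinct by adding a
  staircase, so that partitions correspond to sets of \<open>m\<close> positions on the half-line.
\<close>

definition beta_set :: "nat \<Rightarrow> (nat \<Rightarrow> nat) \<Rightarrow> nat set" where
  "beta_set m lam = (\<lambda>j. lam j + m - j) ` {1..m}"

definition count_below :: "nat set \<Rightarrow> nat \<Rightarrow> nat" where
  "count_below X t = card {x \<in> X. x < t}"

lemma finite_below [simp]: "finite {x \<in> X. x < (t::nat)}"
  by (rule finite_subset[of _ "{..<t}"]) auto

lemma count_below_0 [simp]: "count_below X 0 = 0"
  by (simp add: count_below_def)

lemma count_below_Suc: "count_below X (Suc t) = count_below X t + (if t \<in> X then 1 else 0)"
proof -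
  have "{x \<in> X. x < Suc t} = (if t \<in> X then insert t {x \<in> X. x < t} else {x \<in> X. x < t})"
    by (auto simp: less_Suc_eq)
  then show ?thesis by (simp add: count_below_def)
qed

lemma count_below_le_card: "finite X \<Longrightarrow> count_below X t \<le> card X"
  unfolding count_below_def by (rule card_mono) auto

lemma count_below_complement:
  assumes "X \<subseteq> {..<w}"
  shows "count_below ({..<w} - X) t + count_below X t = min t w"
proof (induction t)
  case (Suc t)
  then show ?case using assms by (auto simp: count_below_Suc)
qed simp

lemma beta_set_strict:
  assumes "is_partition lam" "1 \<le> j" "j < k" "k \<le> m"
  shows "lam k + m - k < lam j + m - j"
  using partition_antimono[OF assms(1,2), of k] assms by linarith

lemma inj_on_beta: "is_partition lam \<Longrightarrow> inj_on (\<lambda>j. lam j + m - j) {1..m}"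
  by (rule linorder_inj_onI') (use beta_set_strict in force)

lemma finite_beta_set [simp]: "finite (beta_set m lam)"
  by (simp add: beta_set_def)

lemma card_beta_set: "is_partition lam \<Longrightarrow> card (beta_set m lam) = m"
  unfolding beta_set_def by (subst card_image[OF inj_on_beta]) simp_all

text \<open>
  The element \<open>lam j + m - j\<close> is the one with \<open>m - j\<close> smaller elements in the set, so it lies
  below \<open>t\<close> exactly when more than \<open>m - j\<close> elements do. This turns inequalities between parts
  into inequalities between counting functions.
\<close>

lemma part_less_iff_count:
  assumes lam: "is_partition lam" and j: "1 \<le> j" "j \<le> m"
  shows "lam j + m - j < t \<longleftrightarrow> m - j < count_below (beta_set m lam) t"
proof -
  let ?g = "\<lambda>j. lam j + m - j" and ?K = "{k \<in> {1..m}. lam k + m - k < t}"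
  have "{x \<in> beta_set m lam. x < t} = ?g ` ?K"
    by (auto simp: beta_set_def)
  then have cnt: "count_below (beta_set m lam) t = card ?K"
    unfolding count_below_def
    by (simp add: card_image inj_on_subset[OF inj_on_beta[OF lam, of m]] subset_eq)
  show ?thesis
  proof
    assume less: "?g j < t"
    have "{j..m} \<subseteq> ?K"
    proof
      fix k assume "k \<in> {j..m}"
      with j less beta_set_strict[OF lam, of j k m] show "k \<in> ?K"
        by (cases "k = j") auto
    qed
    then have "card {j..m} \<le> card ?K" by (intro card_mono) auto
    with cnt j show "m - j < count_below (beta_set m lam) t" by simp
  next
    assume more: "m - j < count_below (beta_set m lam) t"
    show "?g j < t"
    proof (rule ccontr)
      assume nless: "\<not> ?g j < t"
      have "?K \<subseteq> {Suc j..m}"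
      proof
        fix k assume k: "k \<in> ?K"
        with nless have "\<not> k < j"
          using beta_set_strict[OF lam, of k j m] j by auto
        moreover have "k \<noteq> j" using k nless by auto
        ultimately show "k \<in> {Suc j..m}" using k by auto
      qed
      then have "card ?K \<le> card {Suc j..m}" by (intro card_mono) auto
      with cnt more show False by simp
    qed
  qed
qed

lemma beta_set_inject:
  assumes "is_partition lam" "is_partition nu" "\<And>i. i > m \<Longrightarrow> lam i = 0" "\<And>i. i > m \<Longrightarrow> nu i = 0"
    and eq: "beta_set m lam = beta_set m nu"
  shows "lam = nu"
proof
  fix i show "lam i = nu i"
  proof (cases "1 \<le> i \<and> i \<le> m")
    case True
    then have "lam i + m - i < t \<longleftrightarrow> nu i + m - i < t" for t
      using part_less_iff_count[of _ i m t] assms(1,2) eq by simp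
    then have "lam i + m - i = nu i + m - i"
      by (metis less_irrefl linorder_neqE_nat)
    with True show ?thesis by linarith
  next
    case False
    with assms show ?thesis by (cases "i = 0") (auto simp: is_partition_def)
  qed
qed

text \<open>
  In increasing order the element number \<open>k\<close> of a set, counted from 0, is at least \<open>k\<close>, so
  subtracting the staircase leaves natural numbers.
\<close>

lemma beta_set_exists:
  assumes fin: "finite X" and card: "card X = m"
  shows "\<exists>lam. is_partition lam \<and> (\<forall>i>m. lam i = 0) \<and> beta_set m lam = X"
proof -
  define xs where "xs = sorted_list_of_set X"
  have len: "length xs = m" and set: "set xs = X" and sorted: "sorted_wrt (<) xs"
    using fin card by (simp_all add: xs_def)
  have less: "xs ! k < xs ! l" if "k < l" "l < m" for k l
    using sorted that len by (simp add: sorted_wrt_iff_nth_less)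
  have ge: "k \<le> xs ! k" if "k < m" for k
    using that
  proof (induction k)
    case (Suc k)
    then show ?case using less[of k "Suc k"] by simp
  qed simp
  define lam where "lam j = (if 1 \<le> j \<and> j \<le> m then xs ! (m - j) - (m - j) else 0)" for j
  have "lam (Suc i) \<le> lam i" if i: "1 \<le> i" for i
  proof (cases "Suc i \<le> m")
    case True
    then have "Suc (m - Suc i) = m - i" by simp
    then show ?thesis
      using less[of "m - Suc i" "m - i"] True i by (simp add: lam_def)
  qed (simp add: lam_def)
  then have "is_partition lam"
    by (intro is_partitionI[of _ m]) (auto simp: lam_def)
  moreover have "beta_set m lam = X"
  proof -
    have "beta_set m lam = (\<lambda>j. xs ! (m - j)) ` {1..m}"
      unfolding beta_set_def
    proof (rule image_cong[OF refl])
      fix j assume "j \<in> {1..m}"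
      then show "lam j + m - j = xs ! (m - j)"
        using ge[of "m - j"] by (simp add: lam_def)
    qed
    also have "\<dots> = (!) xs ` ((\<lambda>j. m - j) ` {1..m})"
      by (simp add: image_image)
    also have "(\<lambda>j. m - j) ` {1..m} = {..<m}"
    proof
      show "{..<m} \<subseteq> (\<lambda>j. m - j) ` {1..m}"
      proof
        fix k assume "k \<in> {..<m}"
        then show "k \<in> (\<lambda>j. m - j) ` {1..m}"
          by (intro image_eqI[of _ _ "m - k"]) auto
      qed
    qed auto
    also have "(!) xs ` {..<m} = set xs"
      using len by (auto simp: set_conv_nth)
    finally show ?thesis using set by simp
  qed
  ultimately show ?thesis by (intro exI[of _ lam]) (simp add: lam_def)
qed

text \<open>
  For a strictly decreasing sequence, read as a set of positions, lying pointwise further left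
  means having at least as many elements below every threshold. The hypotheses on \<open>A\<close> and \<open>B\<close>
  are what counting functions satisfy by \<open>part_less_iff_count\<close>; they also admit the shifted
  counting functions that occur for strips.
\<close>

lemma pointwise_le_iff_counts:
  fixes a b A B :: "nat \<Rightarrow> nat"
  assumes a: "\<And>j t. 1 \<le> j \<Longrightarrow> j \<le> m \<Longrightarrow> a j < t \<longleftrightarrow> m - j < A t"
    and b: "\<And>j t. 1 \<le> j \<Longrightarrow> j \<le> m \<Longrightarrow> b j < t \<longleftrightarrow> m - j < B t"
    and B: "\<And>t. B t \<le> m"
  shows "(\<forall>j\<in>{1..m}. a j \<le> b j) \<longleftrightarrow> (\<forall>t. B t \<le> A t)"
proof
  assume le: "\<forall>j\<in>{1..m}. a j \<le> b j"
  show "\<forall>t. B t \<le> A t"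
  proof
    fix t show "B t \<le> A t"
    proof (cases "B t = 0")
      case False
      \<comment> \<open>the largest index whose element is counted by \<open>B t\<close>\<close>
      define j where "j = Suc m - B t"
      have j: "1 \<le> j" "j \<le> m" "m - j < B t" "Suc (m - j) = B t"
        using False B[of t] by (simp_all add: j_def)
      then have "b j < t" using b by simp
      with le j have "a j < t" by (meson atLeastAtMost_iff le_less_trans)
      with a j show ?thesis by simp
    qed simp
  qed
next
  assume le: "\<forall>t. B t \<le> A t"
  show "\<forall>j\<in>{1..m}. a j \<le> b j"
  proof
    fix j assume j: "j \<in> {1..m}"
    then have "m - j < B (Suc (b j))" using b[of j "Suc (b j)"] by simp
    also have "\<dots> \<le> A (Suc (b j))" using le by simp
    finally show "a j \<le> b j" using a[of j "Suc (b j)"] j by simp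
  qed
qed

lemma vertical_iff_counts:
  assumes lam: "is_partition lam" "\<And>i. i > m \<Longrightarrow> lam i = 0"
    and nu: "is_partition nu" "\<And>i. i > m \<Longrightarrow> nu i = 0"
  shows "(\<forall>i\<ge>1. lam i \<le> nu i \<and> nu i \<le> Suc (lam i)) \<longleftrightarrow>
    (\<forall>t. count_below (beta_set m nu) t \<le> count_below (beta_set m lam) t \<and>
         count_below (beta_set m lam) t \<le> count_below (beta_set m nu) (Suc t))"
    (is "?L \<longleftrightarrow> ?R")
proof -
  let ?F = "count_below (beta_set m lam)" and ?G = "count_below (beta_set m nu)"
  have bound: "?F t \<le> m" "?G t \<le> m" for t
    using count_below_le_card[OF finite_beta_set] card_beta_set lam(1) nu(1) by metis+
  have 1: "?L \<longleftrightarrow> (\<forall>i\<in>{1..m}. lam i \<le> nu i \<and> nu i \<le> Suc (lam i))"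
    using lam(2) nu(2) by (metis atLeastAtMost_iff le_SucI not_le order_refl)
  have 2: "(\<forall>i\<in>{1..m}. lam i \<le> nu i \<and> nu i \<le> Suc (lam i)) \<longleftrightarrow> (\<forall>i\<in>{1..m}. lam i + m - i \<le> nu i + m - i) \<and>
      (\<forall>i\<in>{1..m}. nu i + m - i \<le> Suc (lam i + m - i))"
  proof -
    have "lam i \<le> nu i \<longleftrightarrow> lam i + m - i \<le> nu i + m - i"
      "nu i \<le> Suc (lam i) \<longleftrightarrow> nu i + m - i \<le> Suc (lam i + m - i)" if "i \<in> {1..m}" for i
      using that by auto
    then show ?thesis by blast
  qed
  have 3: "(\<forall>i\<in>{1..m}. lam i + m - i \<le> nu i + m - i) \<longleftrightarrow> (\<forall>t. ?G t \<le> ?F t)"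
    by (rule pointwise_le_iff_counts)
      (use part_less_iff_count lam(1) nu(1) bound in auto)
  have 4: "(\<forall>i\<in>{1..m}. nu i + m - i \<le> Suc (lam i + m - i)) \<longleftrightarrow> (\<forall>t. ?F (t - 1) \<le> ?G t)"
  proof (rule pointwise_le_iff_counts)
    fix j t assume j: "1 \<le> j" "j \<le> m"
    show "Suc (lam j + m - j) < t \<longleftrightarrow> m - j < ?F (t - 1)"
      using part_less_iff_count[OF lam(1) j, of "t - 1"] by auto
  qed (use part_less_iff_count nu(1) bound in auto)
  have 5: "(\<forall>t. ?F (t - 1) \<le> ?G t) \<longleftrightarrow> (\<forall>t. ?F t \<le> ?G (Suc t))"
  proof
    assume le: "\<forall>t. ?F (t - 1) \<le> ?G t"
    show "\<forall>t. ?F t \<le> ?G (Suc t)"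
    proof
      fix t show "?F t \<le> ?G (Suc t)" using le[rule_format, of "Suc t"] by simp
    qed
  next
    assume le: "\<forall>t. ?F t \<le> ?G (Suc t)"
    show "\<forall>t. ?F (t - 1) \<le> ?G t"
    proof
      fix t show "?F (t - 1) \<le> ?G t" by (cases t) (simp_all add: le)
    qed
  qed
  show ?thesis unfolding 1 2 3 4 5 by blast
qed

lemma interlacing_iff_counts:
  assumes lam: "is_partition lam" "\<And>i. i > m \<Longrightarrow> lam i = 0"
    and nu: "is_partition nu" "\<And>i. i > Suc m \<Longrightarrow> nu i = 0"
  shows "(\<forall>i\<ge>1. lam i \<le> nu i \<and> nu (Suc i) \<le> lam i) \<longleftrightarrow>
    (\<forall>t. count_below (beta_set m lam) t \<le> count_below (beta_set (Suc m) nu) t \<and>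
         count_below (beta_set (Suc m) nu) (Suc t) \<le> Suc (count_below (beta_set m lam) t))"
    (is "?L \<longleftrightarrow> ?R")
proof -
  let ?F = "count_below (beta_set m lam)" and ?G = "count_below (beta_set (Suc m) nu)"
  have bound: "?F t \<le> m" "?G t \<le> Suc m" for t
    using count_below_le_card[OF finite_beta_set] card_beta_set lam(1) nu(1) by metis+
  have 1: "?L \<longleftrightarrow> (\<forall>i\<in>{1..m}. lam i \<le> nu i \<and> nu (Suc i) \<le> lam i)"
    using lam(2) nu(2) by (metis Suc_less_eq atLeastAtMost_iff le0 not_le order_refl)
  have 2: "(\<forall>i\<in>{1..m}. lam i \<le> nu i \<and> nu (Suc i) \<le> lam i) \<longleftrightarrow> (\<forall>i\<in>{1..m}. lam i + m - i \<le> nu i + m - i) \<and>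
      (\<forall>i\<in>{1..m}. nu (Suc i) + m - i \<le> lam i + m - i)"
  proof -
    have "lam i \<le> nu i \<longleftrightarrow> lam i + m - i \<le> nu i + m - i"
      "nu (Suc i) \<le> lam i \<longleftrightarrow> nu (Suc i) + m - i \<le> lam i + m - i" if "i \<in> {1..m}" for i
      using that by auto
    then show ?thesis by blast
  qed
  have 3: "(\<forall>i\<in>{1..m}. lam i + m - i \<le> nu i + m - i) \<longleftrightarrow> (\<forall>t. ?G (Suc t) - 1 \<le> ?F t)"
  proof (rule pointwise_le_iff_counts)
    fix j t assume j: "1 \<le> j" "j \<le> m"
    show "nu j + m - j < t \<longleftrightarrow> m - j < ?G (Suc t) - 1"
      using part_less_iff_count[OF nu(1) j(1), of "Suc m" "Suc t"] j
      by (simp add: Suc_diff_le less_diff_conv)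
  next
    fix t show "?G (Suc t) - 1 \<le> m" using bound(2)[of "Suc t"] by simp
  qed (use part_less_iff_count lam(1) in auto)
  have 4: "(\<forall>i\<in>{1..m}. nu (Suc i) + m - i \<le> lam i + m - i) \<longleftrightarrow> (\<forall>t. ?F t \<le> ?G t)"
  proof (rule pointwise_le_iff_counts)
    fix j t assume j: "1 \<le> j" "j \<le> m"
    show "nu (Suc j) + m - j < t \<longleftrightarrow> m - j < ?G t"
      using part_less_iff_count[OF nu(1), of "Suc j" "Suc m" t] j by simp
  qed (use part_less_iff_count lam(1) bound in auto)
  have 5: "(\<forall>t. ?G (Suc t) - 1 \<le> ?F t) \<longleftrightarrow> (\<forall>t. ?G (Suc t) \<le> Suc (?F t))"
    by (simp add: le_diff_conv)
  show ?thesis unfolding 1 2 3 4 5 by blast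
qed

section \<open>Matchings that move each point by at most one\<close>

definition shift_matching :: "nat set \<Rightarrow> nat set \<Rightarrow> (nat \<times> nat) set \<Rightarrow> bool" where
  "shift_matching C S M \<longleftrightarrow>
     M \<subseteq> {(a, b). a \<in> C \<and> b \<in> S \<and> (b = a \<or> b = Suc a)} \<and>
     (\<forall>a\<in>C. \<exists>!b. (a, b) \<in> M) \<and> (\<forall>b\<in>S. \<exists>!a. (a, b) \<in> M)"

lemma shift_matching_bij:
  assumes M: "shift_matching C S M"
  shows "bij_betw fst M C" "bij_betw snd M S"
proof -
  have "inj_on fst M" "inj_on snd M"
    using M unfolding shift_matching_def inj_on_def by fastforce+
  moreover have "fst ` M = C" "snd ` M = S"
    using M unfolding shift_matching_def by force+
  ultimately show "bij_betw fst M C" "bij_betw snd M S"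
    by (simp_all add: bij_betw_def)
qed

text \<open>
  Only the edge from \<open>t\<close> to \<open>t + 1\<close> can cross the line between \<open>t\<close> and \<open>t + 1\<close>, so the
  difference of the counting functions tells whether this edge is present. In particular the
  matched sets determine the matching.
\<close>

lemma shift_matching_flux:
  assumes M: "shift_matching C S M"
  shows "count_below C (Suc t) = count_below S (Suc t) + (if (t, Suc t) \<in> M then 1 else 0)"
    and "count_below C t \<le> count_below S (Suc t)"
proof -
  have step: "b = a \<or> b = Suc a" "a \<in> C" "b \<in> S" if "(a, b) \<in> M" for a b
    using M that by (auto simp: shift_matching_def)
  have C: "count_below C t = card {p \<in> M. fst p < t}" for t
  proof -
    have "{x \<in> C. x < t} = fst ` {p \<in> M. fst p < t}"
      using shift_matching_bij(1)[OF M] unfolding bij_betw_def by auto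
    then show ?thesis
      using shift_matching_bij(1)[OF M] unfolding bij_betw_def count_below_def
      by (metis (no_types, lifting) card_image inj_on_subset mem_Collect_eq subsetI)
  qed
  have S: "count_below S t = card {p \<in> M. snd p < t}" for t
  proof -
    have "{x \<in> S. x < t} = snd ` {p \<in> M. snd p < t}"
      using shift_matching_bij(2)[OF M] unfolding bij_betw_def by auto
    then show ?thesis
      using shift_matching_bij(2)[OF M] unfolding bij_betw_def count_below_def
      by (metis (no_types, lifting) card_image inj_on_subset mem_Collect_eq subsetI)
  qed
  have fin: "finite {p \<in> M. snd p < t}" for t
    by (rule finite_subset[of _ "{..<t} \<times> {..<t}"]) (use step in force)+
  have "{p \<in> M. fst p < Suc t}
    = (if (t, Suc t) \<in> M then insert (t, Suc t) {p \<in> M. snd p < Suc t} else {p \<in> M. snd p < Suc t})"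
  proof -
    have "a < Suc t \<longleftrightarrow> b < Suc t \<or> (a, b) = (t, Suc t)" if "(a, b) \<in> M" for a b
      using step(1)[OF that] by auto
    then show ?thesis by auto
  qed
  then show "count_below C (Suc t) = count_below S (Suc t) + (if (t, Suc t) \<in> M then 1 else 0)"
    using fin[of "Suc t"] by (simp add: C S)
  have "{p \<in> M. fst p < t} \<subseteq> {p \<in> M. snd p < Suc t}"
    using step by fastforce
  then show "count_below C t \<le> count_below S (Suc t)"
    unfolding C S by (rule card_mono[OF fin])
qed

text \<open>The only candidate for a matching: \<open>a\<close> moves when one more point of \<open>C\<close> than of \<open>S\<close>
  lies in \<open>{..a}\<close>.\<close>

definition flux_matching :: "nat set \<Rightarrow> nat set \<Rightarrow> (nat \<times> nat) set" where
  "flux_matching C S = {(a, b). a \<in> C \<and> b = a + (count_below C (Suc a) - count_below S (Suc a))}"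

lemma shift_matching_unique:
  assumes M: "shift_matching C S M"
  shows "M = flux_matching C S"
proof -
  have "(a, b) \<in> M \<longleftrightarrow> (a, b) \<in> flux_matching C S" for a b
  proof -
    have "a \<in> C \<Longrightarrow> \<exists>!b. (a, b) \<in> M" "(a, b) \<in> M \<Longrightarrow> a \<in> C \<and> (b = a \<or> b = Suc a)"
      for a b
      using M by (auto simp: shift_matching_def)
    then show ?thesis
      using shift_matching_flux(1)[OF M, of a]
      by (cases "(a, Suc a) \<in> M") (force simp: flux_matching_def)+
  qed
  then show ?thesis by auto
qed

text \<open>
  The two inequalities leave only 0 and 1 as values of the difference \<open>\<delta>\<close> of the counting
  functions. That \<open>flux_matching\<close> then hits every point of \<open>S\<close> exactly once follows by
  comparing \<open>\<delta>\<close> at consecutive arguments.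
\<close>

lemma shift_matching_exists:
  assumes le: "\<And>t. count_below S t \<le> count_below C t"
    "\<And>t. count_below C t \<le> count_below S (Suc t)"
  shows "shift_matching C S (flux_matching C S)"
proof -
  let ?C = "count_below C" and ?S = "count_below S"
  have delta: "?C t = ?S t \<or> ?C t = Suc (?S t)" for t
    using le(1)[of t] le(2)[of t] count_below_Suc[of S t] by (auto split: if_splits)
  have target: "b \<in> S \<and> (b = a \<or> b = Suc a)" if "(a, b) \<in> flux_matching C S" for a b
  proof (cases "?C (Suc a) = ?S (Suc a)")
    case True
    with that have "a \<in> C" "b = a" by (auto simp: flux_matching_def)
    with True show ?thesis
      using le(1)[of a] count_below_Suc[of S a] count_below_Suc[of C a] by (auto split: if_splits)
  next
    case False
    with delta[of "Suc a"] that have "?C (Suc a) = Suc (?S (Suc a))" "b = Suc a"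
      by (auto simp: flux_matching_def)
    then show ?thesis
      using le(2)[of "Suc a"] count_below_Suc[of S "Suc a"] by (auto split: if_splits)
  qed
  have source: "\<exists>!a. (a, b) \<in> flux_matching C S" if b: "b \<in> S" for b
  proof -
    have cases_b: "(a, b) \<in> flux_matching C S \<longleftrightarrow>
        (a = b \<and> b \<in> C \<and> ?C (Suc b) = ?S (Suc b)) \<or>
        (Suc a = b \<and> a \<in> C \<and> ?C b = Suc (?S b))" for a
      using delta[of "Suc a"] by (auto simp: flux_matching_def)
    show ?thesis
    proof (cases "?C b = Suc (?S b)")
      case True
      then obtain a where a: "b = Suc a" by (cases b) auto
      have "a \<in> C"
        using True a le(2)[of a] count_below_Suc[of C a] by (auto split: if_splits)
      moreover have "\<not> (b \<in> C \<and> ?C (Suc b) = ?S (Suc b))"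
        using True b count_below_Suc[of C b] count_below_Suc[of S b] by auto
      ultimately show ?thesis using True a cases_b by auto
    next
      case False
      then have "?C b = ?S b" using delta[of b] by blast
      moreover from this have "b \<in> C \<and> ?C (Suc b) = ?S (Suc b)"
        using b count_below_Suc[of C b] count_below_Suc[of S b] le(1)[of "Suc b"]
        by (auto split: if_splits)
      ultimately show ?thesis using cases_b by auto
    qed
  qed
  have "flux_matching C S \<subseteq> {(a, b). a \<in> C \<and> b \<in> S \<and> (b = a \<or> b = Suc a)}"
  proof (rule subrelI)
    fix a b assume ab: "(a, b) \<in> flux_matching C S"
    then have "a \<in> C" by (simp add: flux_matching_def)
    with target[OF ab] show "(a, b) \<in> {(a, b). a \<in> C \<and> b \<in> S \<and> (b = a \<or> b = Suc a)}"
      by simp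
  qed
  moreover have "\<exists>!b. (a, b) \<in> flux_matching C S" if "a \<in> C" for a
    using that by (simp add: flux_matching_def)
  ultimately show ?thesis
    using source unfolding shift_matching_def by simp
qed

lemma shift_matching_iff_counts:
  "(\<exists>M. shift_matching C S M) \<longleftrightarrow>
    (\<forall>t. count_below S t \<le> count_below C t \<and> count_below C t \<le> count_below S (Suc t))"
proof
  assume "\<exists>M. shift_matching C S M"
  then obtain M where M: "shift_matching C S M" by blast
  show "\<forall>t. count_below S t \<le> count_below C t \<and> count_below C t \<le> count_below S (Suc t)"
  proof
    fix t show "count_below S t \<le> count_below C t \<and> count_below C t \<le> count_below S (Suc t)"
      using shift_matching_flux(1)[OF M, of "t - 1"] shift_matching_flux(2)[OF M, of t]
      by (cases t) simp_all
  qed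
qed (use shift_matching_exists in blast)

lemma vertical_iff_matching:
  assumes "is_partition lam" "\<And>i. i > m \<Longrightarrow> lam i = 0"
    and "is_partition nu" "\<And>i. i > m \<Longrightarrow> nu i = 0"
  shows "(\<forall>i\<ge>1. lam i \<le> nu i \<and> nu i \<le> Suc (lam i)) \<longleftrightarrow>
    (\<exists>M. shift_matching (beta_set m lam) (beta_set m nu) M)"
  unfolding shift_matching_iff_counts by (rule vertical_iff_counts[OF assms])

text \<open>
  Interlacing of the particles means that the holes can be matched: passing to complements
  reverses the sign of the counting functions.
\<close>

lemma interlacing_iff_matching:
  assumes lam: "is_partition lam" "\<And>i. i > m \<Longrightarrow> lam i = 0"
    and nu: "is_partition nu" "\<And>i. i > Suc m \<Longrightarrow> nu i = 0"
    and sub: "beta_set m lam \<subseteq> {..<w}" "beta_set (Suc m) nu \<subseteq> {..<Suc w}"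
  shows "(\<forall>i\<ge>1. lam i \<le> nu i \<and> nu (Suc i) \<le> lam i) \<longleftrightarrow>
    (\<exists>M. shift_matching ({..<w} - beta_set m lam) ({..<Suc w} - beta_set (Suc m) nu) M)"
proof -
  let ?F = "count_below (beta_set m lam)" and ?G = "count_below (beta_set (Suc m) nu)"
  let ?C = "count_below ({..<w} - beta_set m lam)"
  let ?S = "count_below ({..<Suc w} - beta_set (Suc m) nu)"
  have comp: "?C t + ?F t = min t w" "?S t + ?G t = min t (Suc w)" for t
    by (rule count_below_complement[OF sub(1)], rule count_below_complement[OF sub(2)])
  have full: "?F t = m" if "w \<le> t" for t
  proof -
    have "{x \<in> beta_set m lam. x < t} = beta_set m lam" using sub that by auto
    then show ?thesis using card_beta_set[OF lam(1)] by (simp add: count_below_def)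
  qed
  have full': "?G t = Suc m" if "Suc w \<le> t" for t
  proof -
    have "{x \<in> beta_set (Suc m) nu. x < t} = beta_set (Suc m) nu" using sub that by auto
    then show ?thesis using card_beta_set[OF nu(1)] by (simp add: count_below_def)
  qed
  have "?F t \<le> ?G t \<and> ?G (Suc t) \<le> Suc (?F t) \<longleftrightarrow> ?S t \<le> ?C t \<and> ?C t \<le> ?S (Suc t)" for t
  proof (cases "t \<le> w")
    case True
    then show ?thesis using comp[of t] comp[of "Suc t"] by auto
  next
    case False
    then show ?thesis
      using comp[of t] comp[of "Suc t"] full[of t] full'[of t] full'[of "Suc t"] by auto
  qed
  then show ?thesis
    unfolding shift_matching_iff_counts using interlacing_iff_counts[OF lam nu] by blast
qed

section \<open>Dominoes as edges between adjacent diagonals\<close>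

text \<open>
  The cell in column \<open>c\<close> of diagonal \<open>d\<close> has exactly two neighbours on diagonal \<open>d + 1\<close>, in
  columns \<open>c\<close> and \<open>c + 1\<close>. So a domino is a triple \<open>(d, a, b)\<close>, where \<open>a\<close> and \<open>b\<close> are the
  columns of its cells on diagonals \<open>d\<close> and \<open>d + 1\<close>.
\<close>

definition edge_cells :: "nat \<times> nat \<times> nat \<Rightarrow> (nat \<times> nat) set" where
  "edge_cells = (\<lambda>(d, a, b). {(a, d), (b, Suc d)})"

definition edge_domino :: "nat \<times> nat \<times> nat \<Rightarrow> (real \<times> real) set" where
  "edge_domino = (\<lambda>(d, a, b). diag_square a d \<union> diag_square b (Suc d))"

definition adjacent_edges :: "(nat \<Rightarrow> nat set) \<Rightarrow> (nat \<times> nat \<times> nat) set" where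
  "adjacent_edges A = {(d, a, b). a \<in> A d \<and> b \<in> A (Suc d) \<and> (b = a \<or> b = Suc a)}"

definition perfect_edge_set :: "(nat \<Rightarrow> nat set) \<Rightarrow> (nat \<times> nat \<times> nat) set \<Rightarrow> bool" where
  "perfect_edge_set A E \<longleftrightarrow> E \<subseteq> adjacent_edges A \<and>
     (\<forall>d. \<forall>c\<in>A d. \<exists>!e. e \<in> E \<and> (c, d) \<in> edge_cells e)"

definition region :: "(nat \<Rightarrow> nat set) \<Rightarrow> (real \<times> real) set" where
  "region A = (\<Union>d. \<Union>c\<in>A d. diag_square c d)"

definition cell_center :: "int \<Rightarrow> int \<Rightarrow> real \<times> real" where
  "cell_center a b = (of_int a + 1/2, of_int b + 1/2)"

lemma half_in_interval_iff:
  "of_int a \<le> of_int b + (1/2::real) \<and> of_int b + 1/2 \<le> of_int a + (1::real) \<longleftrightarrow> a = b"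
  by linarith

lemma cell_center_in_unit_square: "cell_center a b \<in> unit_square a' b' \<longleftrightarrow> a = a' \<and> b = b'"
  using half_in_interval_iff[of a' a] half_in_interval_iff[of b' b]
  by (auto simp: cell_center_def unit_square_def)

lemma cell_center_in_interior: "cell_center a b \<in> interior (unit_square a b)"
proof (rule interiorI)
  let ?U = "{of_int a <..< of_int a + 1 :: real} \<times> {of_int b <..< of_int b + 1 :: real}"
  show "open ?U" by (intro open_Times) auto
  show "cell_center a b \<in> ?U" by (simp add: cell_center_def)
  show "?U \<subseteq> unit_square a b" by (auto simp: unit_square_def)
qed

definition diag_center :: "nat \<Rightarrow> nat \<Rightarrow> real \<times> real" where
  "diag_center c d = cell_center (int c) (int c - int d)"

lemma diag_center_in_diag_square: "diag_center c d \<in> diag_square c' d' \<longleftrightarrow> c = c' \<and> d = d'"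
  by (auto simp: diag_center_def diag_square_def cell_center_in_unit_square)

lemma diag_center_in_edge_domino: "diag_center c d \<in> edge_domino e \<longleftrightarrow> (c, d) \<in> edge_cells e"
  by (cases e) (auto simp: edge_domino_def edge_cells_def diag_center_in_diag_square)

lemma diag_center_in_interior:
  assumes "(c, d) \<in> edge_cells e"
  shows "diag_center c d \<in> interior (edge_domino e)"
proof -
  have "diag_square c d \<subseteq> edge_domino e"
    using assms by (cases e) (auto simp: edge_domino_def edge_cells_def)
  then have "interior (diag_square c d) \<subseteq> interior (edge_domino e)"
    by (rule interior_mono)
  then show ?thesis
    using cell_center_in_interior by (auto simp: diag_center_def diag_square_def)
qed

lemma edge_cells_inject: "edge_cells e = edge_cells e' \<Longrightarrow> e = e'"
  by (cases e; cases e') (auto simp: edge_cells_def doubleton_eq_iff)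

lemma edge_domino_inject: "edge_domino e = edge_domino e' \<Longrightarrow> e = e'"
  by (rule edge_cells_inject) (metis diag_center_in_edge_domino set_eqI surj_pair)

lemma edge_domino_is_domino:
  assumes "e \<in> adjacent_edges A"
  shows "is_domino (edge_domino e)"
proof -
  obtain d a b where e: "e = (d, a, b)" "b = a \<or> b = Suc a"
    using assms by (auto simp: adjacent_edges_def)
  from e(2) show ?thesis
  proof
    assume "b = a"
    then have "edge_domino e = unit_square (int a) (int a - int d - 1)
        \<union> unit_square (int a) (int a - int d - 1 + 1)"
      using e by (auto simp: edge_domino_def diag_square_def algebra_simps)
    then show ?thesis unfolding is_domino_def by blast
  next
    assume "b = Suc a"
    then have "edge_domino e = unit_square (int a) (int a - int d)
        \<union> unit_square (int a + 1) (int a - int d)"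
      using e by (auto simp: edge_domino_def diag_square_def algebra_simps)
    then show ?thesis unfolding is_domino_def by blast
  qed
qed

text \<open>
  A domino inside a union of unit squares consists of two of these squares, because each of
  its halves contains the centre of only one unit square.
\<close>

lemma domino_in_region:
  assumes dom: "is_domino X" and sub: "X \<subseteq> region A"
  shows "\<exists>e\<in>adjacent_edges A. X = edge_domino e"
proof -
  have cell: "\<exists>c d. c \<in> A d \<and> a = int c \<and> b = int c - int d" if "cell_center a b \<in> X" for a b
  proof -
    have "cell_center a b \<in> region A" using that sub by blast
    then obtain c d where "c \<in> A d" "cell_center a b \<in> diag_square c d"
      unfolding region_def by blast
    then show ?thesis
      by (auto simp: diag_square_def cell_center_in_unit_square)
  qed
  obtain a b where "X = unit_square a b \<union> unit_square (a+1) b \<or>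
      X = unit_square a b \<union> unit_square a (b+1)"
    using dom unfolding is_domino_def by blast
  then show ?thesis
  proof
    assume X: "X = unit_square a b \<union> unit_square (a+1) b"
    then obtain c d c' d' where c: "c \<in> A d" "a = int c" "b = int c - int d"
      and c': "c' \<in> A d'" "a + 1 = int c'" "b = int c' - int d'"
      using cell[of a b] cell[of "a+1" b] by (auto simp: cell_center_in_unit_square)
    from c c' have eq: "c' = Suc c" "d' = Suc d" by linarith+
    have "(d, c, c') \<in> adjacent_edges A"
      using c c' eq by (simp add: adjacent_edges_def)
    moreover have "X = edge_domino (d, c, c')"
      unfolding X edge_domino_def using c eq by (simp add: diag_square_def add.commute)
    ultimately show ?thesis by blast
  next
    assume X: "X = unit_square a b \<union> unit_square a (b+1)"
    then obtain c d c' d' where c: "c \<in> A d" "a = int c" "b = int c - int d"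
      and c': "c' \<in> A d'" "a = int c'" "b + 1 = int c' - int d'"
      using cell[of a b] cell[of a "b+1"] by (auto simp: cell_center_in_unit_square)
    from c c' have eq: "c' = c" "d = Suc d'" by linarith+
    have "(d', c', c) \<in> adjacent_edges A"
      using c c' eq by (simp add: adjacent_edges_def)
    moreover have "X = edge_domino (d', c', c)"
    proof -
      have "unit_square a b = diag_square c d" "unit_square a (b+1) = diag_square c' d'"
        by (simp only: diag_square_def c(2,3), simp only: diag_square_def c'(2,3))
      with X eq show ?thesis by (auto simp: edge_domino_def)
    qed
    ultimately show ?thesis by blast
  qed
qed

text \<open>
  A nonempty open set contains a point with no integer coordinate, and such a point lies in
  only one unit square.
\<close>

lemma interiors_disjoint_if_cells_disjoint:
  assumes disj: "edge_cells e \<inter> edge_cells e' = {}"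
  shows "interior (edge_domino e) \<inter> interior (edge_domino e') = {}"
proof (rule ccontr)
  let ?U = "interior (edge_domino e) \<inter> interior (edge_domino e')"
  assume "?U \<noteq> {}"
  then obtain p where p: "p \<in> ?U" by blast
  have "open ?U" by (intro open_Int open_interior)
  then obtain V W where VW: "open V" "open W" "p \<in> V \<times> W" "V \<times> W \<subseteq> ?U"
    using p by (rule open_prod_elim)
  have ctbl: "countable (\<int> :: real set)"
    unfolding Ints_def by (intro countable_image) simp
  have "V \<noteq> {}" "W \<noteq> {}" using VW(3) by auto
  then obtain x y where xy: "x \<in> V" "x \<notin> \<int>" "y \<in> W" "y \<notin> \<int>"
    using open_minus_countable[OF ctbl _ VW(1)] open_minus_countable[OF ctbl _ VW(2)] by blast
  have strict: "\<lfloor>z\<rfloor> = a" if "z \<notin> \<int>" "of_int a \<le> z" "z \<le> of_int a + 1" for z :: real and a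
  proof -
    have "z \<noteq> of_int (a + 1)" using that(1) by (metis Ints_of_int)
    with that show ?thesis by (simp add: floor_eq_iff)
  qed
  have only: "int c = \<lfloor>x\<rfloor> \<and> int c - int d = \<lfloor>y\<rfloor>" if "(x, y) \<in> diag_square c d" for c d
    using that strict[OF xy(2), of "int c"] strict[OF xy(4), of "int c - int d"]
    by (simp add: diag_square_def unit_square_def)
  have cell: "\<exists>c d. (c, d) \<in> edge_cells f \<and> (x, y) \<in> diag_square c d"
    if "(x, y) \<in> interior (edge_domino f)" for f
  proof -
    have "(x, y) \<in> edge_domino f" using that interior_subset by blast
    then show ?thesis by (cases f) (auto simp: edge_domino_def edge_cells_def)
  qed
  have "(x, y) \<in> ?U" using VW xy by blast
  then obtain c d c' d' where c: "(c, d) \<in> edge_cells e" "(x, y) \<in> diag_square c d"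
    and c': "(c', d') \<in> edge_cells e'" "(x, y) \<in> diag_square c' d'"
    using cell[of e] cell[of e'] by blast
  then have "c = c'" "d = d'" using only[of c d] only[of c' d'] by auto
  with c c' disj show False by blast
qed

lemma bij_betw_edge_sets_tilings:
  "bij_betw ((`) edge_domino) {E. perfect_edge_set A E} (domino_tilings (region A))"
  unfolding bij_betw_def
proof
  have "inj edge_domino" by (rule injI) (rule edge_domino_inject)
  then show "inj_on ((`) edge_domino) {E. perfect_edge_set A E}"
    by (auto simp: inj_on_def inj_image_eq_iff)
  show "(`) edge_domino ` {E. perfect_edge_set A E} = domino_tilings (region A)"
  proof (intro equalityI subsetI)
    fix T assume "T \<in> (`) edge_domino ` {E. perfect_edge_set A E}"
    then obtain E where E: "E \<subseteq> adjacent_edges A"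
      "\<And>c d. c \<in> A d \<Longrightarrow> \<exists>!e. e \<in> E \<and> (c, d) \<in> edge_cells e" and T: "T = edge_domino ` E"
      by (auto simp: perfect_edge_set_def)
    have in_A: "c \<in> A d" if "e \<in> E" "(c, d) \<in> edge_cells e" for c d e
      using E(1) that by (auto simp: adjacent_edges_def edge_cells_def)
    have "is_domino X" if "X \<in> T" for X
      using that T E(1) edge_domino_is_domino by auto
    moreover have "interior X \<inter> interior Y = {}" if XY: "X \<in> T" "Y \<in> T" "X \<noteq> Y" for X Y
    proof -
      obtain e e' where e: "e \<in> E" "e' \<in> E" "X = edge_domino e" "Y = edge_domino e'"
        using XY(1,2) unfolding T by (elim imageE)
      have "edge_cells e \<inter> edge_cells e' = {}"
      proof (rule ccontr)
        assume "edge_cells e \<inter> edge_cells e' \<noteq> {}"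
        then obtain c d where "(c, d) \<in> edge_cells e" "(c, d) \<in> edge_cells e'" by auto
        then have "e = e'" using E(2)[of c d] in_A e by blast
        with e XY show False by simp
      qed
      then show ?thesis using interiors_disjoint_if_cells_disjoint e by simp
    qed
    moreover have "\<Union>T = region A"
    proof
      show "\<Union>T \<subseteq> region A"
      proof
        fix p assume "p \<in> \<Union>T"
        then obtain d a b where e: "(d, a, b) \<in> E" "p \<in> edge_domino (d, a, b)"
          unfolding T by auto
        then have "a \<in> A d" "b \<in> A (Suc d)"
          using E(1) by (auto simp: adjacent_edges_def)
        with e(2) show "p \<in> region A"
          unfolding region_def edge_domino_def by blast
      qed
      show "region A \<subseteq> \<Union>T"
      proof
        fix p assume "p \<in> region A"
        then obtain c d where cd: "c \<in> A d" "p \<in> diag_square c d"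
          by (auto simp: region_def)
        then obtain e where "e \<in> E" "(c, d) \<in> edge_cells e" using E(2) by blast
        moreover from this have "p \<in> edge_domino e"
          using cd by (cases e) (auto simp: edge_domino_def edge_cells_def)
        ultimately show "p \<in> \<Union>T" using T by blast
      qed
    qed
    ultimately show "T \<in> domino_tilings (region A)"
      by (simp add: domino_tilings_def)
  next
    fix T assume "T \<in> domino_tilings (region A)"
    then have dom: "\<And>X. X \<in> T \<Longrightarrow> is_domino X"
      and disj: "\<And>X Y. X \<in> T \<Longrightarrow> Y \<in> T \<Longrightarrow> X \<noteq> Y \<Longrightarrow> interior X \<inter> interior Y = {}"
      and un: "\<Union>T = region A"
      by (auto simp: domino_tilings_def)
    define E where "E = {e \<in> adjacent_edges A. edge_domino e \<in> T}"
    have T: "T = edge_domino ` E"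
    proof
      show "T \<subseteq> edge_domino ` E"
      proof
        fix X assume X: "X \<in> T"
        then obtain e where "e \<in> adjacent_edges A" "X = edge_domino e"
          using domino_in_region[OF dom[OF X], of A] un by blast
        with X show "X \<in> edge_domino ` E" by (auto simp: E_def)
      qed
    qed (auto simp: E_def)
    have "\<exists>!e. e \<in> E \<and> (c, d) \<in> edge_cells e" if c: "c \<in> A d" for c d
    proof (rule ex_ex1I)
      have "diag_center c d \<in> \<Union>T"
        unfolding un region_def using c diag_center_in_diag_square by blast
      then show "\<exists>e. e \<in> E \<and> (c, d) \<in> edge_cells e"
        unfolding T using diag_center_in_edge_domino by auto
    next
      fix e e' assume e: "e \<in> E \<and> (c, d) \<in> edge_cells e" and e': "e' \<in> E \<and> (c, d) \<in> edge_cells e'"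
      then have "diag_center c d \<in> interior (edge_domino e) \<inter> interior (edge_domino e')"
        using diag_center_in_interior by blast
      then have "edge_domino e = edge_domino e'"
        using disj[of "edge_domino e" "edge_domino e'"] e e' by (auto simp: E_def)
      then show "e = e'" by (rule edge_domino_inject)
    qed
    then have "perfect_edge_set A E"
      by (auto simp: perfect_edge_set_def E_def)
    with T show "T \<in> (`) edge_domino ` {E. perfect_edge_set A E}" by blast
  qed
qed

section \<open>Sequences and tilings\<close>

text \<open>
  The edges between two consecutive diagonals form a layer. Every cell that is not matched
  with the diagonal before is matched with the next one, so a perfect edge set amounts to
  perfect matchings in all layers.
\<close>

definition layer :: "(nat \<times> nat \<times> nat) set \<Rightarrow> nat \<Rightarrow> (nat \<times> nat) set" where
  "layer E d = {(a, b). (d, a, b) \<in> E}"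

definition matched_down :: "(nat \<times> nat \<times> nat) set \<Rightarrow> nat \<Rightarrow> nat set" where
  "matched_down E d = {b. \<exists>d' a. d = Suc d' \<and> (d', a, b) \<in> E}"

lemma mem_edge_cells: "(c, d) \<in> edge_cells (d', a, b) \<longleftrightarrow> (d = d' \<and> c = a) \<or> (d = Suc d' \<and> c = b)"
  by (auto simp: edge_cells_def)

lemma perfect_edge_set_layers:
  assumes E: "perfect_edge_set A E"
  shows "matched_down E 0 = {}" "matched_down E d \<subseteq> A d"
    "shift_matching (A d - matched_down E d) (matched_down E (Suc d)) (layer E d)"
proof -
  have adj: "a \<in> A d \<and> b \<in> A (Suc d) \<and> (b = a \<or> b = Suc a)" if "(d, a, b) \<in> E" for d a b
    using E that by (auto simp: perfect_edge_set_def adjacent_edges_def)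
  have ex1: "\<exists>!e. e \<in> E \<and> (c, d) \<in> edge_cells e" if "c \<in> A d" for c d
    using E that by (auto simp: perfect_edge_set_def)
  show "matched_down E 0 = {}" "matched_down E d \<subseteq> A d"
    using adj by (auto simp: matched_down_def)
  have up: "a \<notin> matched_down E d" if "(d, a, b) \<in> E" for d a b
  proof
    assume "a \<in> matched_down E d"
    then obtain d' a' where d': "d = Suc d'" "(d', a', a) \<in> E"
      by (auto simp: matched_down_def)
    have "(d', a', a) = (d, a, b)"
      using ex1[of a d] adj[OF that] that d' mem_edge_cells by blast
    with d' show False by simp
  qed
  show "shift_matching (A d - matched_down E d) (matched_down E (Suc d)) (layer E d)"
    unfolding shift_matching_def
  proof (intro conjI ballI)
    show "layer E d \<subseteq> {(a, b). a \<in> A d - matched_down E d \<and> b \<in> matched_down E (Suc d) \<and>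
        (b = a \<or> b = Suc a)}"
      using adj up by (auto simp: layer_def matched_down_def)
  next
    fix a assume a: "a \<in> A d - matched_down E d"
    then obtain d' x y where e: "(d', x, y) \<in> E" "(a, d) \<in> edge_cells (d', x, y)"
      using ex1[of a d] by auto
    then have "d' = d" "x = a"
      using a by (auto simp: mem_edge_cells matched_down_def)
    moreover have "b = b'" if "(d, a, b) \<in> E" "(d, a, b') \<in> E" for b b'
      using ex1[of a d] a that mem_edge_cells by blast
    ultimately show "\<exists>!b. (a, b) \<in> layer E d"
      using e by (auto simp: layer_def)
  next
    fix b assume "b \<in> matched_down E (Suc d)"
    then obtain a where a: "(d, a, b) \<in> E" by (auto simp: matched_down_def)
    moreover have "a = a'" if "(d, a', b) \<in> E" for a'
      using ex1[of b "Suc d"] adj[OF a] a that mem_edge_cells by blast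
    ultimately show "\<exists>!a. (a, b) \<in> layer E d"
      by (auto simp: layer_def)
  qed
qed

lemma perfect_edge_setI:
  assumes S0: "S 0 = {}" and S: "\<And>d. S d \<subseteq> A d"
    and M: "\<And>d. shift_matching (A d - S d) (S (Suc d)) (layer E d)"
  shows "perfect_edge_set A E" "matched_down E = S"
proof -
  have adj: "a \<in> A d \<and> a \<notin> S d \<and> b \<in> S (Suc d) \<and> (b = a \<or> b = Suc a)" if "(d, a, b) \<in> E" for d a b
    using M[of d] that by (auto simp: shift_matching_def layer_def)
  have up: "\<exists>!b. (d, a, b) \<in> E" if "a \<in> A d" "a \<notin> S d" for d a
    using M[of d] that by (simp add: shift_matching_def layer_def)
  have down: "\<exists>!a. (d, a, b) \<in> E" if "b \<in> S (Suc d)" for d b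
    using M[of d] that by (simp add: shift_matching_def layer_def)
  show "matched_down E = S"
  proof
    fix d show "matched_down E d = S d"
    proof (cases d)
      case 0
      then show ?thesis using S0 by (simp add: matched_down_def)
    next
      case (Suc d')
      have "\<exists>a. (d', a, b) \<in> E" if "b \<in> S (Suc d')" for b
        using down[OF that] by blast
      with Suc adj show ?thesis by (auto simp: matched_down_def)
    qed
  qed
  have "\<exists>!e. e \<in> E \<and> (c, d) \<in> edge_cells e" if c: "c \<in> A d" for c d
  proof (cases "c \<in> S d")
    case True
    then obtain d' where d': "d = Suc d'" using S0 by (cases d) auto
    have ex1: "\<exists>!a. (d', a, c) \<in> E" using down True d' by simp
    then obtain a where a: "(d', a, c) \<in> E" by blast
    show ?thesis
    proof (rule ex1I)
      show "(d', a, c) \<in> E \<and> (c, d) \<in> edge_cells (d', a, c)"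
        using a d' by (simp add: mem_edge_cells)
      fix e assume e: "e \<in> E \<and> (c, d) \<in> edge_cells e"
      obtain k x y where k: "e = (k, x, y)" by (cases e)
      show "e = (d', a, c)"
      proof -
        have kx: "(k, x, y) \<in> E" using e k by simp
        have "\<not> (d = k \<and> c = x)" using adj[OF kx] True by blast
        with e k d' have "k = d'" "y = c" by (auto simp: mem_edge_cells)
        with kx a ex1 k show ?thesis by blast
      qed
    qed
  next
    case False
    have ex1: "\<exists>!b. (d, c, b) \<in> E" using up c False by simp
    then obtain b where b: "(d, c, b) \<in> E" by blast
    show ?thesis
    proof (rule ex1I)
      show "(d, c, b) \<in> E \<and> (c, d) \<in> edge_cells (d, c, b)"
        using b by (simp add: mem_edge_cells)
      fix e assume e: "e \<in> E \<and> (c, d) \<in> edge_cells e"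
      obtain k x y where k: "e = (k, x, y)" by (cases e)
      show "e = (d, c, b)"
      proof -
        have kx: "(k, x, y) \<in> E" using e k by simp
        have "\<not> (d = Suc k \<and> c = y)" using adj[OF kx] False by blast
        with e k have "k = d" "x = c" by (auto simp: mem_edge_cells)
        with kx b ex1 k show ?thesis by blast
      qed
    qed
  qed
  moreover have "E \<subseteq> adjacent_edges A"
    using adj S by (force simp: adjacent_edges_def)
  ultimately show "perfect_edge_set A E"
    by (simp add: perfect_edge_set_def)
qed

definition aztec_diagonal :: "nat \<Rightarrow> (nat \<Rightarrow> nat) \<Rightarrow> nat \<Rightarrow> nat set" where
  "aztec_diagonal n mu d =
     (if d < 2*n then {..<mu 1 + (d+1) div 2} else if d = 2*n then beta_set n mu else {})"

lemma aztec_triangle2_eq_region: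
  assumes "1 \<le> n"
  shows "aztec_triangle2 n mu = region (aztec_diagonal n mu)"
proof -
  have d: "d \<le> 2*n-1 \<longleftrightarrow> d < 2*n" for d using assms by auto
  have P: "{mu j + n - j | j. 1 \<le> j \<and> j \<le> n} = beta_set n mu"
    by (auto simp: beta_set_def)
  show ?thesis
  proof (rule set_eqI)
    fix p
    have "p \<in> aztec_triangle2 n mu \<longleftrightarrow>
        (\<exists>d c. p \<in> diag_square c d \<and> d < 2*n \<and> c < mu 1 + (d+1) div 2) \<or>
        (\<exists>c. p \<in> diag_square c (2*n) \<and> c \<in> beta_set n mu)"
      unfolding aztec_triangle2_def d P by blast
    also have "\<dots> \<longleftrightarrow> (\<exists>d c. p \<in> diag_square c d \<and> c \<in> aztec_diagonal n mu d)"
      unfolding aztec_diagonal_def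
      by (metis (no_types, lifting) empty_iff lessThan_iff less_irrefl)
    also have "\<dots> \<longleftrightarrow> p \<in> region (aztec_diagonal n mu)"
      unfolding region_def by blast
    finally show "p \<in> aztec_triangle2 n mu \<longleftrightarrow> p \<in> region (aztec_diagonal n mu)" .
  qed
qed

text \<open>
  The particles on diagonal \<open>d\<close> are the cells matched with diagonal \<open>d - 1\<close> when \<open>d\<close> is even and
  the cells matched with diagonal \<open>d + 1\<close> when \<open>d\<close> is odd. From an odd to an even diagonal the
  dominoes move particles, otherwise they move holes.
\<close>

definition particles :: "(nat \<Rightarrow> nat set) \<Rightarrow> (nat \<Rightarrow> nat set) \<Rightarrow> nat \<Rightarrow> nat set" where
  "particles A S d = (if even d then S d else A d - S d)"

definition chain_matched_down :: "nat \<Rightarrow> (nat \<Rightarrow> nat) \<Rightarrow> (nat \<Rightarrow> nat) list \<Rightarrow> nat \<Rightarrow> nat set" where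
  "chain_matched_down n mu L d = (if d > 2*n then {}
     else if even d then beta_set ((d+1) div 2) (L ! d)
     else aztec_diagonal n mu d - beta_set ((d+1) div 2) (L ! d))"

definition edges_of_chain ::
    "nat \<Rightarrow> (nat \<Rightarrow> nat) \<Rightarrow> (nat \<Rightarrow> nat) list \<Rightarrow> (nat \<times> nat \<times> nat) set" where
  "edges_of_chain n mu L = {(d, a, b). (a, b) \<in> flux_matching
     (aztec_diagonal n mu d - chain_matched_down n mu L d) (chain_matched_down n mu L (Suc d))}"

text \<open>
  On an even diagonal \<open>A d - S d\<close> is the set of holes and on an odd one the set of particles, so
  the matching criteria for interlacing and for vertical strips apply in turn.
\<close>

lemma strip_conditions_iff_matchings:
  assumes part: "\<And>d. d \<le> 2*n \<Longrightarrow> is_partition (f d)"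
    and num: "\<And>d i. d \<le> 2*n \<Longrightarrow> i > (d+1) div 2 \<Longrightarrow> f d i = 0"
    and S: "\<And>d. d \<le> 2*n \<Longrightarrow> S d \<subseteq> aztec_diagonal n mu d"
    and X: "\<And>d. d \<le> 2*n \<Longrightarrow> particles (aztec_diagonal n mu) S d = beta_set ((d+1) div 2) (f d)"
    and k: "k < n"
  shows "(\<forall>i\<ge>1. f (2*k) i \<le> f (2*k+1) i \<and> f (2*k+1) (Suc i) \<le> f (2*k) i) \<longleftrightarrow>
      (\<exists>M. shift_matching (aztec_diagonal n mu (2*k) - S (2*k)) (S (2*k+1)) M)"
    and "(\<forall>i\<ge>1. f (2*k+1) i \<le> f (2*k+2) i \<and> f (2*k+2) i \<le> Suc (f (2*k+1) i)) \<longleftrightarrow>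
      (\<exists>M. shift_matching (aztec_diagonal n mu (2*k+1) - S (2*k+1)) (S (2*k+2)) M)"
proof -
  have le: "2*k \<le> 2*n" "2*k+1 \<le> 2*n" "2*k+2 \<le> 2*n" using k by auto
  have A: "aztec_diagonal n mu (2*k) = {..<mu 1 + k}"
    "aztec_diagonal n mu (2*k+1) = {..<Suc (mu 1 + k)}"
    using k by (simp_all add: aztec_diagonal_def)
  have X': "S (2*k) = beta_set k (f (2*k))"
    "aztec_diagonal n mu (2*k+1) - S (2*k+1) = beta_set (Suc k) (f (2*k+1))"
    "S (2*k+2) = beta_set (Suc k) (f (2*k+2))"
    using X[OF le(1)] X[OF le(2)] X[OF le(3)] by (simp_all add: particles_def)
  have S1: "S (2*k+1) = {..<Suc (mu 1 + k)} - beta_set (Suc k) (f (2*k+1))"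
    using S[OF le(2)] X'(2) A(2) by blast
  have sub: "beta_set k (f (2*k)) \<subseteq> {..<mu 1 + k}"
    "beta_set (Suc k) (f (2*k+1)) \<subseteq> {..<Suc (mu 1 + k)}"
    using S[OF le(1)] X' A by auto
  show "(\<forall>i\<ge>1. f (2*k) i \<le> f (2*k+1) i \<and> f (2*k+1) (Suc i) \<le> f (2*k) i) \<longleftrightarrow>
      (\<exists>M. shift_matching (aztec_diagonal n mu (2*k) - S (2*k)) (S (2*k+1)) M)"
    unfolding S1 X'(1) A(1)
    by (rule interlacing_iff_matching[OF part[OF le(1)] _ part[OF le(2)] _ sub])
      (use num[OF le(1)] num[OF le(2)] in auto)
  show "(\<forall>i\<ge>1. f (2*k+1) i \<le> f (2*k+2) i \<and> f (2*k+2) i \<le> Suc (f (2*k+1) i)) \<longleftrightarrow>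
      (\<exists>M. shift_matching (aztec_diagonal n mu (2*k+1) - S (2*k+1)) (S (2*k+2)) M)"
    unfolding X'(2,3)
    by (rule vertical_iff_matching[OF part[OF le(2)] _ part[OF le(3)]])
      (use num[OF le(2)] num[OF le(3)] in auto)
qed

lemma chain_beta_subset:
  assumes f: "strip_chain n mu f" and d: "d \<le> 2*n"
  shows "beta_set ((d+1) div 2) (f d) \<subseteq> aztec_diagonal n mu d"
proof (cases "d = 2*n")
  case True
  then show ?thesis using f by (simp add: aztec_diagonal_def strip_chain_def)
next
  case False
  have last: "f (2*n) = mu" and mu: "is_partition mu"
    using f unfolding strip_chain_def by blast+
  show ?thesis
  proof
    fix x assume "x \<in> beta_set ((d+1) div 2) (f d)"
    then obtain j where j: "1 \<le> j" "j \<le> (d+1) div 2" "x = f d j + (d+1) div 2 - j"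
      by (auto simp: beta_set_def)
    have "f d j \<le> mu j" using strip_chain_mono[OF f d, of j] j last by simp
    also have "\<dots> \<le> mu 1" using partition_antimono[OF mu, of 1 j] j by simp
    finally have "x < mu 1 + (d+1) div 2" using j by linarith
    then show "x \<in> aztec_diagonal n mu d" using d False by (simp add: aztec_diagonal_def)
  qed
qed

lemma chain_particles:
  assumes L: "L \<in> case2_sequences (2*n+1) mu" and d: "d \<le> 2*n"
  shows "particles (aztec_diagonal n mu) (chain_matched_down n mu L) d
    = beta_set ((d+1) div 2) (L ! d)"
proof -
  have "strip_chain n mu ((!) L)"
    using L unfolding case2_iff_strip_chain by blast
  from chain_beta_subset[OF this d] d show ?thesis
    by (auto simp: particles_def chain_matched_down_def)
qed

lemma edges_of_chain_perfect:
  assumes L: "L \<in> case2_sequences (2*n+1) mu"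
  shows "perfect_edge_set (aztec_diagonal n mu) (edges_of_chain n mu L)"
    and "matched_down (edges_of_chain n mu L) = chain_matched_down n mu L"
proof -
  define f where "f = (!) L"
  let ?A = "aztec_diagonal n mu" and ?S = "chain_matched_down n mu L"
  have f: "strip_chain n mu f"
    using L unfolding case2_iff_strip_chain f_def by blast
  have part: "\<And>d. d \<le> 2*n \<Longrightarrow> is_partition (f d)"
    and hor: "\<And>k. k < n \<Longrightarrow> \<forall>i\<ge>1. f (2*k) i \<le> f (2*k+1) i \<and> f (2*k+1) (Suc i) \<le> f (2*k) i"
    and ver: "\<And>k. k < n \<Longrightarrow> \<forall>i\<ge>1. f (2*k+1) i \<le> f (2*k+2) i \<and> f (2*k+2) i \<le> Suc (f (2*k+1) i)"
    and num: "\<And>d i. d \<le> 2*n \<Longrightarrow> i > (d+1) div 2 \<Longrightarrow> f d i = 0"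
    and last: "f (2*n) = mu"
    using f unfolding strip_chain_def by blast+
  have S: "?S d \<subseteq> ?A d" for d
    using chain_beta_subset[OF f, of d] by (auto simp: chain_matched_down_def f_def)
  have S0: "?S 0 = {}"
    by (simp add: chain_matched_down_def beta_set_def)
  have X: "particles ?A ?S d = beta_set ((d+1) div 2) (f d)" if d: "d \<le> 2*n" for d
    using chain_particles[OF L d] by (simp add: f_def)
  note iff = strip_conditions_iff_matchings[where f = f and S = ?S and mu = mu and n = n, OF part num S X]
  have ex: "\<exists>M. shift_matching (?A d - ?S d) (?S (Suc d)) M" for d
  proof (cases "d < 2*n")
    case less: True
    show ?thesis
    proof (cases "even d")
      case True
      then obtain k where k: "d = 2*k" by (rule evenE)
      with less have kn: "k < n" by simp
      show ?thesis using iff(1)[of k] hor[OF kn] kn k by simp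
    next
      case False
      then obtain k where k: "d = 2*k+1" by (rule oddE)
      with less have kn: "k < n" by simp
      show ?thesis using iff(2)[of k] ver[OF kn] kn k by simp
    qed
  next
    case False
    then have "?A d - ?S d = {}" "?S (Suc d) = {}"
      by (auto simp: aztec_diagonal_def chain_matched_down_def last[unfolded f_def])
    moreover have "shift_matching {} {} {}"
      by (simp add: shift_matching_def)
    ultimately show ?thesis by metis
  qed
  have "shift_matching (?A d - ?S d) (?S (Suc d)) (layer (edges_of_chain n mu L) d)" for d
  proof -
    have "layer (edges_of_chain n mu L) d = flux_matching (?A d - ?S d) (?S (Suc d))"
      by (auto simp: layer_def edges_of_chain_def)
    then show ?thesis using ex[of d] shift_matching_unique by metis
  qed
  from perfect_edge_setI[of ?S ?A, OF S0 S this]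
  show "perfect_edge_set (aztec_diagonal n mu) (edges_of_chain n mu L)"
    "matched_down (edges_of_chain n mu L) = chain_matched_down n mu L"
    by simp_all
qed

lemma edges_of_chain_inj: "inj_on (edges_of_chain n mu) (case2_sequences (2*n+1) mu)"
proof (rule inj_onI)
  fix L L' assume L: "L \<in> case2_sequences (2*n+1) mu" and L': "L' \<in> case2_sequences (2*n+1) mu"
    and eq: "edges_of_chain n mu L = edges_of_chain n mu L'"
  have S: "chain_matched_down n mu L = chain_matched_down n mu L'"
    using edges_of_chain_perfect(2)[OF L] edges_of_chain_perfect(2)[OF L'] eq by simp
  have "L ! d = L' ! d" if d: "d \<le> 2*n" for d
  proof (rule beta_set_inject)
    show "beta_set ((d+1) div 2) (L ! d) = beta_set ((d+1) div 2) (L' ! d)"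
      using chain_particles[OF L d] chain_particles[OF L' d] S by simp
    show "is_partition (L ! d)" "is_partition (L' ! d)"
      "\<And>i. (d+1) div 2 < i \<Longrightarrow> (L ! d) i = 0" "\<And>i. (d+1) div 2 < i \<Longrightarrow> (L' ! d) i = 0"
      using L L' d unfolding case2_iff_strip_chain strip_chain_def by blast+
  qed
  then show "L = L'"
    by (intro case2_sequence_eqI[OF L L']) simp
qed

text \<open>
  Conversely, matched sets have the same size, so going up the diagonals determines the number
  of particles on each of them, and the particles encode a partition.
\<close>

lemma card_particles:
  assumes E: "perfect_edge_set (aztec_diagonal n mu) E" and d: "d \<le> 2*n"
  shows "finite (particles (aztec_diagonal n mu) (matched_down E) d) \<and>
    card (particles (aztec_diagonal n mu) (matched_down E) d) = (d+1) div 2"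
proof -
  let ?A = "aztec_diagonal n mu" and ?S = "matched_down E"
  note lay = perfect_edge_set_layers[OF E]
  have fin: "finite (?A k)" for k by (simp add: aztec_diagonal_def)
  have finS: "finite (?S k)" for k using finite_subset[OF lay(2) fin] .
  have step: "card (?S (Suc k)) = card (?A k) - card (?S k)" for k
  proof -
    have "card (?A k - ?S k) = card (?S (Suc k))"
      using bij_betw_same_card shift_matching_bij[OF lay(3)[of k]] by metis
    then show ?thesis by (simp add: card_Diff_subset[OF finS lay(2)])
  qed
  have cardA: "card (?A k) = mu 1 + (k+1) div 2" if "k < 2*n" for k
    using that by (simp add: aztec_diagonal_def)
  have "card (?S (2*k)) = k \<and> (k < n \<longrightarrow> card (?S (2*k+1)) = mu 1)" if "k \<le> n" for k
    using that
  proof (induction k)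
    case 0
    show ?case using step[of 0] lay(1) cardA[of 0] by auto
  next
    case (Suc k)
    then have kn: "k < n" and IH: "card (?S (2*k+1)) = mu 1" by auto
    have a: "card (?S (2 * Suc k)) = Suc k"
      using step[of "2*k+1"] cardA[of "2*k+1"] IH kn by simp
    moreover have "card (?S (2 * Suc k + 1)) = mu 1" if "Suc k < n"
      using step[of "2 * Suc k"] cardA[of "2 * Suc k"] a that by simp
    ultimately show ?case by blast
  qed
  note cardS = this
  show ?thesis
  proof (cases "even d")
    case True
    then obtain k where "d = 2*k" by (rule evenE)
    with d show ?thesis using cardS[of k] finS by (simp add: particles_def)
  next
    case False
    then obtain k where k: "d = 2*k+1" by (rule oddE)
    with d have "k < n" by linarith
    with k have "d < 2*n" by linarith
    with k \<open>k < n\<close> show ?thesis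
      using cardS[of k] cardA[of d] fin card_Diff_subset[OF finS lay(2), of d]
      by (simp add: particles_def)
  qed
qed

lemma edges_of_chain_surj:
  assumes mu: "is_partition mu" "num_parts mu \<le> n"
    and E: "perfect_edge_set (aztec_diagonal n mu) E"
  shows "\<exists>L\<in>case2_sequences (2*n+1) mu. E = edges_of_chain n mu L"
proof -
  let ?A = "aztec_diagonal n mu" and ?S = "matched_down E"
  let ?X = "particles ?A ?S"
  note lay = perfect_edge_set_layers[OF E]
  define P where "P d lam \<longleftrightarrow> is_partition lam \<and> (\<forall>i>(d+1) div 2. lam i = 0) \<and>
      beta_set ((d+1) div 2) lam = ?X d" for d lam
  have "\<exists>lam. P d lam" if d: "d \<le> 2*n" for d
    unfolding P_def using card_particles[OF E d] by (intro beta_set_exists) simp_all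
  then have "\<forall>d. \<exists>lam. d \<le> 2*n \<longrightarrow> P d lam" by blast
  then obtain f where P: "\<forall>d. d \<le> 2*n \<longrightarrow> P d (f d)" by (rule choice[THEN exE])
  then have part: "\<And>d. d \<le> 2*n \<Longrightarrow> is_partition (f d)"
    and num: "\<And>d i. d \<le> 2*n \<Longrightarrow> i > (d+1) div 2 \<Longrightarrow> f d i = 0"
    and X: "\<And>d. d \<le> 2*n \<Longrightarrow> ?X d = beta_set ((d+1) div 2) (f d)"
    by (simp_all add: P_def)
  note iff = strip_conditions_iff_matchings[where f = f and S = ?S and mu = mu and n = n,
      OF part num lay(2) X]
  have "f (2*n) = mu"
  proof (rule beta_set_inject)
    \<comment> \<open>There is no diagonal after the last one, so all its cells are matched downwards.\<close>
    have "layer E (2*n) \<subseteq> ?A (2*n) \<times> ?A (Suc (2*n))"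
      using E by (auto simp: perfect_edge_set_def adjacent_edges_def layer_def)
    then have "layer E (2*n) = {}" by (simp add: aztec_diagonal_def)
    then have "?A (2*n) - ?S (2*n) = {}"
      using lay(3)[of "2*n"] by (auto simp: shift_matching_def)
    then have "?S (2*n) = beta_set n mu"
      using lay(2)[of "2*n"] by (auto simp: aztec_diagonal_def)
    then show "beta_set n (f (2*n)) = beta_set n mu"
      using X[of "2*n"] by (simp add: particles_def)
    show "is_partition (f (2*n))" "\<And>i. n < i \<Longrightarrow> f (2*n) i = 0"
      using part[of "2*n"] num[of "2*n"] by simp_all
    show "is_partition mu" "\<And>i. n < i \<Longrightarrow> mu i = 0"
      using mu by (simp_all add: num_parts_le_iff)
  qed
  moreover have "\<forall>i\<ge>1. f (2*k) i \<le> f (2*k+1) i \<and> f (2*k+1) (Suc i) \<le> f (2*k) i" if "k < n" for k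
    using iff(1)[OF _ _ _ _ that] lay(3)[of "2*k"] by auto
  moreover have "\<forall>i\<ge>1. f (2*k+1) i \<le> f (2*k+2) i \<and> f (2*k+2) i \<le> Suc (f (2*k+1) i)" if "k < n" for k
    using iff(2)[OF _ _ _ _ that] lay(3)[of "2*k+1"] by auto
  ultimately have chain: "strip_chain n mu f"
    using part num unfolding strip_chain_def by blast
  let ?L = "map f [0..<2*n+1]"
  note L = case2_sequenceI[OF chain]
  have nth: "?L ! d = f d" if "d \<le> 2*n" for d
    using that by (subst nth_map) (auto simp del: upt_Suc)
  have S: "chain_matched_down n mu ?L = ?S"
  proof
    fix d
    show "chain_matched_down n mu ?L d = ?S d"
    proof (cases "d \<le> 2*n")
      case True
      have "particles ?A (chain_matched_down n mu ?L) d = ?X d"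
        using chain_particles[OF L True] nth[OF True] X[OF True] by simp
      moreover have "chain_matched_down n mu ?L d \<subseteq> ?A d" "?S d \<subseteq> ?A d"
        using perfect_edge_set_layers(2)[OF edges_of_chain_perfect(1)[OF L], of d]
          edges_of_chain_perfect(2)[OF L] lay(2) by auto
      ultimately show ?thesis
        by (cases "even d") (auto simp: particles_def)
    next
      case False
      then have "?S d = {}" using lay(2)[of d] by (simp add: aztec_diagonal_def)
      with False show ?thesis by (simp add: chain_matched_down_def)
    qed
  qed
  have "(d, a, b) \<in> E \<longleftrightarrow> (d, a, b) \<in> edges_of_chain n mu ?L" for d a b
  proof -
    have "layer E d = flux_matching (?A d - ?S d) (?S (Suc d))"
      by (rule shift_matching_unique[OF lay(3)])
    moreover have "(d, a, b) \<in> edges_of_chain n mu ?L \<longleftrightarrow>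
        (a, b) \<in> flux_matching (?A d - ?S d) (?S (Suc d))"
      unfolding edges_of_chain_def S by simp
    ultimately show ?thesis by (auto simp: layer_def)
  qed
  then have "E = edges_of_chain n mu ?L" by auto
  with L show ?thesis by blast
qed

lemma bij_betw_chains_tilings:
  assumes "1 \<le> n" "is_partition mu" "num_parts mu \<le> n"
  shows "bij_betw ((`) edge_domino \<circ> edges_of_chain n mu)
    (case2_sequences (2*n+1) mu) (domino_tilings (aztec_triangle2 n mu))"
proof (rule bij_betw_trans)
  show "bij_betw (edges_of_chain n mu) (case2_sequences (2*n+1) mu)
      {E. perfect_edge_set (aztec_diagonal n mu) E}"
    unfolding bij_betw_def
    using edges_of_chain_inj edges_of_chain_perfect(1) edges_of_chain_surj[OF assms(2,3)] by blast
  show "bij_betw ((`) edge_domino) {E. perfect_edge_set (aztec_diagonal n mu) E}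
      (domino_tilings (aztec_triangle2 n mu))"
    unfolding aztec_triangle2_eq_region[OF assms(1)] by (rule bij_betw_edge_sets_tilings)
qed

section \<open>The four bijections\<close>

theorem theorem3p13:
  fixes n :: nat and mu :: "nat \<Rightarrow> nat"
  assumes "n \<ge> 1" and "is_partition mu" and "num_parts mu \<le> n"
  shows "finite (case2_sequences (2 * n + 1) mu) \<and>
         finite (tableaux_below (Unbarred (n + 1)) mu) \<and>
         finite (nonintersecting_h_delannoy n mu) \<and>
         finite (domino_tilings (aztec_triangle2 n mu)) \<and>
         (\<exists>f. bij_betw f (case2_sequences (2 * n + 1) mu) (tableaux_below (Unbarred (n + 1)) mu)) \<and>
         (\<exists>g. bij_betw g (tableaux_below (Unbarred (n + 1)) mu) (nonintersecting_h_delannoy n mu)) \<and>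
         (\<exists>h. bij_betw h (nonintersecting_h_delannoy n mu) (domino_tilings (aztec_triangle2 n mu)))"
proof -
  let ?C = "case2_sequences (2 * n + 1) mu" and ?T = "tableaux_below (Unbarred (n + 1)) mu"
    and ?P = "nonintersecting_h_delannoy n mu" and ?D = "domino_tilings (aztec_triangle2 n mu)"
  obtain f where f: "bij_betw f ?C ?T"
    using bij_betw_chains_tableaux[OF assms(2)] by blast
  obtain g where g: "bij_betw g ?C ?P"
    using bij_betw_chains_paths[OF assms(2,3)] by blast
  obtain h where h: "bij_betw h ?C ?D"
    using bij_betw_chains_tilings[OF assms] by blast
  have fin: "finite ?T" by (rule finite_tableaux_below[OF assms(2)])
  then have finC: "finite ?C" using bij_betw_finite[OF f] by simp
  then have "finite ?P" "finite ?D"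
    using bij_betw_finite[OF g] bij_betw_finite[OF h] by simp_all
  moreover have "bij_betw (g \<circ> inv_into ?C f) ?T ?P" "bij_betw (h \<circ> inv_into ?C g) ?P ?D"
    using bij_betw_trans[OF bij_betw_inv_into[OF f] g] bij_betw_trans[OF bij_betw_inv_into[OF g] h]
    by simp_all
  ultimately show ?thesis using fin finC f by blast
qed

end
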